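(* Let $\mathcal A$ be a cluster algebra without coefficients of rank $2$ with initial exchange matrix $B=\begin{pmatrix}0&b\\-c&0\end{pmatrix}$, $b,c\in\mathbb Z_{>0}$. Then $\{\rho_h|_{y_i\to1,\forall i\in[1,2]}\mid h\in\mathbb Z^2\}$ and the greedy basis $\{x[d]\mid d\in\mathbb Z^2\}$ are the same. More precisely, $\rho_h|_{y_i\to1,\forall i\in[1,2]}=x[d]$ for any $h=(h_1,h_2)\in\mathbb Z^2$, where $d=(d_1,d_2)=(-h_1,\,-h_2+c[-h_1]_+)$.
   Context: $[x]_+=\max(x,0)$; $X=(x_1,x_2)$ is the initial cluster, $X^\alpha=x_1^{\alpha_1}x_2^{\alpha_2}$. For integers $i$ and $j\ge0$, $\binom ij=\frac{i(i-1)\cdots(i-j+1)}{j!}$ ($=1$ if $j=0$); $\tilde C_i^j=\binom ij$ if $i>0$ and $\tilde C_i^j=0$ if $i\le0$. $l(\overline{pq})$ is the length of the segment $\overline{pq}$. **Greedy elements.** $x[d]=X^{-d}\sum_{u,v\in\mathbb N}c(u,v)x_1^{bu}x_2^{cv}$ with $c(0,0)=1$ and, for $(u,v)\in\mathbb N^2\setminus\{(0,0)\}$, $$c(u,v)=\max\Big\{\sum_{k=1}^u(-1)^{k-1}c(u-k,v)\binom{d_2-cv+k-1}{k},\ \sum_{k=1}^v(-1)^{k-1}c(u,v-k)\binom{d_1-bu+k-1}{k}\Big\}.$$ **$\rho_h$ in rank 2.** It is defined for the cluster algebra with principal coefficients with the same exchange matrix $B$, where $\hat y_1=y_1x_2^{-c}$,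 $\hat y_2=y_2x_1^{b}$, $\hat Y^{(u,v)}=\hat y_1^u\hat y_2^v$. For $h=(h_1,h_2)\in\mathbb Z^2$ let $v_1=(0,0)$, $v_2=([-h_1]_+,0)$, $v_3=([-h_1]_+,[-h_2+c[-h_1]_+]_+)$. For a lattice point $p_0=(u_0,v_0)$ on $\overline{p_1p_2}$, where $p_1p_2$ is $v_1v_2$ or $v_2v_3$, set $co_{p_0}=\binom{l(\overline{p_1p_2})}{l(\overline{p_0p_2})}$ (equal to $1$ when the segment degenerates to a point), $m_1(p_0)=co_{p_0}$ if $u_0=-h_1$ and $0$ otherwise, $m_2(p_0)=co_{p_0}$ if $v_0=0$ and $0$ otherwise. For any other lattice point $p=(u,v)$: $co_p=m_1(p)=m_2(p)=0$ if $u>[-h_1]_+$ or $v<0$; otherwise, inductively, $$co_p=\max\Big\{\sum_{i=1}^{[-h_1]_+-u}m_1((u+i,v))\tilde C^i_{-h_1-bv},\ \sum_{i=1}^vm_2((u,v-i))\tilde C^i_{-h_2+cu}\Big\},$$ $$m_1(p)=co_p-\sum_{i=1}^{[-h_1]_+-u}m_1((u+i,v))\tilde C^i_{-h_1-bv},\qquad m_2(p)=co_p-\sum_{i=1}^vm_2((u,v-i))\tilde C^i_{-h_2+cu}.$$ $N_h$ is the convex hull of $\{p\in\mathbb N^2\mid co_p\ne0\}$ with weight $co_p$ at each point $p$, and $\rho_h=\sum_{p\in N_h}co_p\hat Y^pX^h$ (a finite sum over lattice points).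
   Formalization: In the greedy recursion the upper binomial entries are read as [d_2-cv]_+ +k-1 and [d_1-bu]_+ +k-1; with the printed entries the claim fails, e.g. b=c=2, d=(1,1) gives c(1,1)=-1 where the matching weight of rho_h is 0. *)

theory Defs
  imports "HOL-Analysis.Analysis" "HOL-Library.Poly_Mapping"
begin

text \<open>
  The exchange matrix is \<open>B\<close> with rows \<open>(0, b)\<close> and \<open>(-c, 0)\<close>.  The Laurent polynomial
  ring in \<open>x\<^sub>1, x\<^sub>2\<close> is the group ring of \<open>\<int>\<^sup>2\<close> over \<open>\<int>\<close>; with principal coefficients, the
  exponent of a monomial is a pair (exponent of \<open>x\<close>, exponent of \<open>y\<close>).
\<close>

type_synonym laurent = "(int \<times> int) \<Rightarrow>\<^sub>0 int"
type_synonym laurent_prin = "((int \<times> int) \<times> (int \<times> int)) \<Rightarrow>\<^sub>0 int"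

abbreviation pos_part :: "int \<Rightarrow> int"
  where "pos_part x \<equiv> max x 0"

definition monomial :: "'e \<Rightarrow> 'e \<Rightarrow>\<^sub>0 int"
  where "monomial \<alpha> = Poly_Mapping.single \<alpha> 1"


text \<open>
  The parser admits \<open>gchoose\<close> only over fields of characteristic \<open>0\<close>, so its defining equation
  is repeated here for \<open>int\<close>; the division is exact.
\<close>

definition int_binom :: "int \<Rightarrow> nat \<Rightarrow> int"
  where "int_binom i j = (\<Prod>k = 0..<j. i - int k) div fact j"


section \<open>Greedy elements\<close>

text \<open>
  The upper entries of the binomials carry the positive part \<open>[d\<^sub>2 - c v]\<^sub>+\<close> resp.
  \<open>[d\<^sub>1 - b u]\<^sub>+\<close>, so that the corresponding sum vanishes if \<open>d\<^sub>2 - c v \<le> 0\<close> resp.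
  \<open>d\<^sub>1 - b u \<le> 0\<close>.  Equivalently, \<open>binom(d\<^sub>2 - c v + k - 1, k)\<close> counts as \<open>0\<close> when its upper
  entry is not positive.  With the polynomial value for negative upper entries one would get
  negative coefficients and, in general, no Laurent polynomial: already for \<open>b = c = 2\<close> and
  \<open>d = (1, 1)\<close> that gives the coefficient \<open>-1\<close> instead of \<open>0\<close> at \<open>(u, v) = (1, 1)\<close>.
\<close>

function greedy_coeff :: "int \<Rightarrow> int \<Rightarrow> int \<times> int \<Rightarrow> nat \<Rightarrow> nat \<Rightarrow> int" where
  "greedy_coeff b c d u v =
     (if u = 0 \<and> v = 0 then 1
      else max
        (\<Sum>k = 1..u. (-1) ^ (k - 1) * greedy_coeff b c d (u - k) v
           * int_binom (pos_part (snd d - c * int v) + int k - 1) k)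
        (\<Sum>k = 1..v. (-1) ^ (k - 1) * greedy_coeff b c d u (v - k)
           * int_binom (pos_part (fst d - b * int u) + int k - 1) k))"
  by auto
termination
  by (relation "Wellfounded.measure (\<lambda>(b, c, d, u, v). u + v)") auto

declare greedy_coeff.simps [simp del]

definition greedy_support :: "int \<Rightarrow> int \<Rightarrow> int \<times> int \<Rightarrow> (nat \<times> nat) set"
  where "greedy_support b c d = {(u, v). greedy_coeff b c d u v \<noteq> 0}"

definition greedy_element :: "int \<Rightarrow> int \<Rightarrow> int \<times> int \<Rightarrow> laurent"
  where "greedy_element b c d =
    monomial (- d) * (\<Sum>(u, v)\<in>greedy_support b c d.
      of_int (greedy_coeff b c d u v) * monomial (b * int u, c * int v))"


section \<open>The weighted polytope of \<open>h\<close>\<close>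

definition emb :: "int \<times> int \<Rightarrow> real \<times> real"
  where "emb p = (real_of_int (fst p), real_of_int (snd p))"

definition vert1 :: "int \<times> int"
  where "vert1 = (0, 0)"

definition vert2 :: "int \<times> int \<Rightarrow> int \<times> int"
  where "vert2 h = (pos_part (- fst h), 0)"

definition vert3 :: "int \<Rightarrow> int \<times> int \<Rightarrow> int \<times> int"
  where "vert3 c h = (pos_part (- fst h), pos_part (- snd h + c * pos_part (- fst h)))"

definition on_segment :: "int \<times> int \<Rightarrow> int \<times> int \<Rightarrow> int \<times> int \<Rightarrow> bool"
  where "on_segment p0 p1 p2 \<longleftrightarrow> emb p0 \<in> closed_segment (emb p1) (emb p2)"

text \<open>Only used for axis-parallel segments, whose lattice points are at integral distance.\<close>

definition seg_length :: "int \<times> int \<Rightarrow> int \<times> int \<Rightarrow> nat"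
  where "seg_length p q = nat \<lfloor>dist (emb p) (emb q)\<rfloor>"

definition on_boundary :: "int \<Rightarrow> int \<times> int \<Rightarrow> int \<times> int \<Rightarrow> bool"
  where "on_boundary c h p \<longleftrightarrow>
    on_segment p vert1 (vert2 h) \<or> on_segment p (vert2 h) (vert3 c h)"

text \<open>At the common point \<open>vert2 h\<close> of the two segments both formulas give \<open>1\<close>.\<close>

definition boundary_co :: "int \<Rightarrow> int \<times> int \<Rightarrow> int \<times> int \<Rightarrow> int"
  where "boundary_co c h p =
    (if on_segment p vert1 (vert2 h)
     then int (seg_length vert1 (vert2 h) choose seg_length p (vert2 h))
     else int (seg_length (vert2 h) (vert3 c h) choose seg_length p (vert3 c h)))"

definition Ctilde :: "int \<Rightarrow> nat \<Rightarrow> int"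
  where "Ctilde i j = (if i > 0 then int_binom i j else 0)"

function co :: "int \<Rightarrow> int \<Rightarrow> int \<times> int \<Rightarrow> int \<Rightarrow> int \<Rightarrow> int"
  and m1 :: "int \<Rightarrow> int \<Rightarrow> int \<times> int \<Rightarrow> int \<Rightarrow> int \<Rightarrow> int"
  and m2 :: "int \<Rightarrow> int \<Rightarrow> int \<times> int \<Rightarrow> int \<Rightarrow> int \<Rightarrow> int"
where
  "co b c h u v =
     (if on_boundary c h (u, v) then boundary_co c h (u, v)
      else if u > pos_part (- fst h) \<or> v < 0 then 0
      else max
        (\<Sum>i = 1..nat (pos_part (- fst h) - u).
           m1 b c h (u + int i) v * Ctilde (- fst h - b * v) i)
        (\<Sum>i = 1..nat v. m2 b c h u (v - int i) * Ctilde (- snd h + c * u) i))"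
| "m1 b c h u v =
     (if on_boundary c h (u, v) then (if u = - fst h then co b c h u v else 0)
      else if u > pos_part (- fst h) \<or> v < 0 then 0
      else co b c h u v
        - (\<Sum>i = 1..nat (pos_part (- fst h) - u).
             m1 b c h (u + int i) v * Ctilde (- fst h - b * v) i))"
| "m2 b c h u v =
     (if on_boundary c h (u, v) then (if v = 0 then co b c h u v else 0)
      else if u > pos_part (- fst h) \<or> v < 0 then 0
      else co b c h u v
        - (\<Sum>i = 1..nat v. m2 b c h u (v - int i) * Ctilde (- snd h + c * u) i))"
  by pat_completeness auto
termination
  by (relation "Wellfounded.measure (\<lambda>x. case x of
        Inl (b, c, h, u, v) \<Rightarrow> 2 * nat (pos_part (- fst h) - u + v)
      | Inr (Inl (b, c, h, u, v)) \<Rightarrow> 2 * nat (pos_part (- fst h) - u + v) + 1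
      | Inr (Inr (b, c, h, u, v)) \<Rightarrow> 2 * nat (pos_part (- fst h) - u + v) + 1)") auto

declare co.simps [simp del] m1.simps [simp del] m2.simps [simp del]

definition N_polytope :: "int \<Rightarrow> int \<Rightarrow> int \<times> int \<Rightarrow> (real \<times> real) set"
  where "N_polytope b c h =
    convex hull {emb (u, v) |u v. u \<ge> 0 \<and> v \<ge> 0 \<and> co b c h u v \<noteq> 0}"

definition N_lattice_points :: "int \<Rightarrow> int \<Rightarrow> int \<times> int \<Rightarrow> (int \<times> int) set"
  where "N_lattice_points b c h = {p. emb p \<in> N_polytope b c h}"


section \<open>The elements \<open>\<rho>\<^sub>h\<close>\<close>

definition yhat1 :: "int \<Rightarrow> laurent_prin"
  where "yhat1 c = monomial ((0, - c), (1, 0))"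

definition yhat2 :: "int \<Rightarrow> laurent_prin"
  where "yhat2 b = monomial ((b, 0), (0, 1))"

text \<open>
  The polytope is contained in the nonnegative quadrant, so \<open>nat\<close> truncates nothing here.
\<close>

definition rho :: "int \<Rightarrow> int \<Rightarrow> int \<times> int \<Rightarrow> laurent_prin"
  where "rho b c h =
    (\<Sum>(u, v)\<in>N_lattice_points b c h.
       of_int (co b c h u v) * (yhat1 c ^ nat u * yhat2 b ^ nat v) * monomial (h, 0))"

text \<open>The substitution \<open>y\<^sub>1, y\<^sub>2 \<rightarrow> 1\<close>: the additive extension of \<open>X\<^sup>\<alpha> Y\<^sup>\<beta> \<mapsto> X\<^sup>\<alpha>\<close>.\<close>

definition y_to_1 :: "laurent_prin \<Rightarrow> laurent"
  where "y_to_1 = frag_extend (\<lambda>(\<alpha>, \<beta>). monomial \<alpha>)"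

end

theory Submission
  imports Defs
begin

text \<open>
  Write \<open>A = [-h\<^sub>1]\<^sub>+\<close> and \<open>d = (-h\<^sub>1, -h\<^sub>2 + c A)\<close>.  Under \<open>y \<rightarrow> 1\<close> the lattice point \<open>(A - p, v)\<close>
  contributes the monomial with exponent \<open>-d + (b v, c p)\<close>, so the claim is that its weight is the
  greedy coefficient at \<open>(v, p)\<close>, and that the polytope misses no greedy coefficient.

  The weights agree because both recursions describe the same division of generating functions.
  The greedy recursion says that a row divided by \<open>(1 + X) ^ [d\<^sub>1 - b u]\<^sub>+\<close> and a column divided by
  \<open>(1 + X) ^ [d\<^sub>2 - c v]\<^sub>+\<close> have nonnegative coefficients, of which at least one is zero at each point
  other than the origin (\<open>greedy_coeff_unique\<close>).  The weights \<open>m1\<close> and \<open>m2\<close>, wherever they are used, are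
  these quotients, and the recursion for \<open>co\<close> multiplies them back (\<open>weights_eq_greedy_coeff\<close>).

  The substance is that the greedy coefficients vanish unless \<open>u \<le> [d\<^sub>2]\<^sub>+\<close> and \<open>v \<le> [d\<^sub>1]\<^sub>+\<close>: the
  polytope ends there.  If \<open>d\<^sub>1 \<le> 0\<close> or \<open>d\<^sub>2 \<le> 0\<close>, only the first column, respectively the
  first row, survives.  For positive \<open>d\<^sub>1, d\<^sub>2\<close> the coefficients are interpreted, following Lee, Li and Zelevinsky, as numbers of compatible
  pairs: a set \<open>S1\<close> of \<open>v\<close> horizontal and a set \<open>S2\<close> of \<open>u\<close> vertical edges of the periodic lattice path
  hugging the diagonal of a \<open>d\<^sub>1 \<times> d\<^sub>2\<close> rectangle.  The bounds are then immediate, as there are only \<open>d\<^sub>1\<close>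
  horizontal and \<open>d\<^sub>2\<close> vertical edges.

  The interpretation rests on shadows.  Every edge of \<open>S2\<close> shadows the next \<open>b\<close> unshadowed horizontal
  edges to its left, so \<open>[d\<^sub>1 - b u]\<^sub>+\<close> horizontal edges stay unshadowed (\<open>card_unshadowed\<close>).
  Compatibility does not constrain those, hence dividing row \<open>u\<close> by \<open>(1 + X) ^ [d\<^sub>1 - b u]\<^sub>+\<close> leaves the
  number of compatible pairs with \<open>S1\<close> inside the shadow (\<open>strip_card_pairs\<close>).  For such pairs,
  comparison of token counts with the height of the path shows that \<open>(u, v)\<close> lies strictly on one side
  of the line \<open>c d\<^sub>1 v = b d\<^sub>2 u\<close> (\<open>shadowed_pairs_below_diagonal\<close>).  Reversal of the path exchanges
  rows and columns, and puts the column quotients strictly on the other side.  So at least one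
  quotient vanishes, which is the greedy recursion.
\<close>

section \<open>Division by a power of 1 + X\<close>

lemma falling_product_eq_fact_binomial:
  "(\<Prod>k = 0..<j. int n - int k) = fact j * int (n choose j)"
proof (induction j)
  case 0
  then show ?case by simp
next
  case (Suc j)
  have "int (Suc j) * int (n choose Suc j) = int (n choose j) * (int n - int j)"
  proof (cases "j \<le> n")
    case True
    have "Suc j * (n choose Suc j) = (n choose j) * (n - j)"
      by (metis binomial_absorption binomial_absorb_comp mult.commute)
    then show ?thesis
      using True by (metis of_nat_diff of_nat_mult)
  qed (simp add: binomial_eq_0)
  then have "fact (Suc j) * int (n choose Suc j) = fact j * int (n choose j) * (int n - int j)"
    by (simp add: mult_ac)
  then show ?case
    using Suc by simp
qed

lemma int_binom_of_nat: "int_binom (int n) j = int (n choose j)"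
  by (simp add: int_binom_def falling_product_eq_fact_binomial)

lemma int_binom_0 [simp]: "int_binom i 0 = 1"
  by (simp add: int_binom_def)

lemma rising_binom_Suc:
  "int_binom (int M + int (Suc k) - 1) (Suc k) = int (M + k choose Suc k)"
  using int_binom_of_nat[of "M + k" "Suc k"] by simp

definition neg_power_series :: "nat \<Rightarrow> int fps"
  where "neg_power_series M = Abs_fps (\<lambda>k. (-1) ^ k * int_binom (int M + int k - 1) k)"

text \<open>
  The coefficient of order \<open>0\<close> is separate because for \<open>M = 0\<close> its upper entry is \<open>-1\<close>.
\<close>

lemma neg_power_series_nth:
  "fps_nth (neg_power_series M) 0 = 1"
  "fps_nth (neg_power_series M) (Suc k) = - ((-1) ^ k * int (M + k choose Suc k))"
  using rising_binom_Suc[of M k] by (simp_all add: neg_power_series_def)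

lemma neg_power_series_inverse: "neg_power_series M * (1 + fps_X) ^ M = 1"
proof (induction M)
  case 0
  have "fps_nth (neg_power_series 0) k = fps_nth 1 k" for k
    by (cases k) (simp_all add: neg_power_series_nth)
  then show ?case by (simp add: fps_eq_iff)
next
  case (Suc M)
  have "neg_power_series (Suc M) * (1 + fps_X) = neg_power_series M"
  proof (rule fps_ext)
    fix k
    show "fps_nth (neg_power_series (Suc M) * (1 + fps_X)) k = fps_nth (neg_power_series M) k"
    proof (cases k)
      case (Suc l)
      then show ?thesis
        by (cases l) (simp_all add: neg_power_series_nth distrib_left algebra_simps)
    qed (simp add: neg_power_series_nth distrib_left)
  qed
  then show ?case
    using Suc by (simp add: mult.assoc[symmetric])
qed

text \<open>
  This is the coefficient of \<open>X ^ n\<close> in \<open>a(X) / (1 + X) ^ M\<close>.  Both recursions below are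
  statements about it: the alternating sums in the greedy recursion are \<open>a n - strip M a n\<close>,
  and the auxiliary weights \<open>m1\<close>, \<open>m2\<close>, wherever they are used, are stripped rows and columns
  of \<open>co\<close>.
\<close>

definition strip :: "nat \<Rightarrow> (nat \<Rightarrow> int) \<Rightarrow> nat \<Rightarrow> int"
  where "strip M a n = a n -
    (\<Sum>k = 1..n. (-1) ^ (k - 1) * a (n - k) * int_binom (int M + int k - 1) k)"

lemma strip_eq_fps: "strip M a n = fps_nth (neg_power_series M * Abs_fps a) n"
proof -
  have "fps_nth (neg_power_series M * Abs_fps a) n =
      (\<Sum>k = 0..n. (-1) ^ k * int_binom (int M + int k - 1) k * a (n - k))"
    by (simp add: fps_mult_nth neg_power_series_def)
  also have "\<dots> = a n + (\<Sum>k = 1..n. (-1) ^ k * int_binom (int M + int k - 1) k * a (n - k))"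
    by (subst sum.atLeast_Suc_atMost) auto
  also have "(\<Sum>k = 1..n. (-1) ^ k * int_binom (int M + int k - 1) k * a (n - k)) =
      - (\<Sum>k = 1..n. (-1) ^ (k - 1) * a (n - k) * int_binom (int M + int k - 1) k)"
    unfolding sum_negf[symmetric]
  proof (rule sum.cong)
    fix k assume "k \<in> {1..n}"
    then obtain l where "k = Suc l" by (cases k) auto
    then show "(-1) ^ k * int_binom (int M + int k - 1) k * a (n - k) =
        - ((-1) ^ (k - 1) * a (n - k) * int_binom (int M + int k - 1) k)"
      by simp
  qed simp
  finally show ?thesis by (simp add: strip_def)
qed

lemma one_plus_X_power_nth: "fps_nth ((1 + fps_X :: int fps) ^ M) k = int (M choose k)"
proof (induction M arbitrary: k)
  case (Suc M)
  then show ?case by (cases k) (simp_all add: distrib_right)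
qed (simp add: fps_one_nth)

lemma times_one_plus_X_power_nth:
  "fps_nth (Abs_fps r * (1 + fps_X) ^ M) n = (\<Sum>k\<le>n. r (n - k) * int (M choose k))"
  by (subst mult.commute)
    (simp add: fps_mult_nth one_plus_X_power_nth atLeast0AtMost mult.commute[of "r _"])

lemma strip_unique:
  assumes "\<And>n. a n = (\<Sum>k\<le>n. r (n - k) * int (M choose k))"
  shows "strip M a n = r n"
proof -
  have "Abs_fps a = Abs_fps r * (1 + fps_X) ^ M"
    by (rule fps_ext) (simp only: assms times_one_plus_X_power_nth fps_nth_Abs_fps)
  then have "neg_power_series M * Abs_fps a = Abs_fps r"
    by (simp add: mult.left_commute neg_power_series_inverse)
  then show ?thesis by (simp add: strip_eq_fps)
qed

lemma unstrip: "a n = (\<Sum>k\<le>n. strip M a (n - k) * int (M choose k))"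
proof -
  have "Abs_fps (strip M a) = neg_power_series M * Abs_fps a"
    by (rule fps_ext) (simp add: strip_eq_fps)
  then have "Abs_fps (strip M a) * (1 + fps_X) ^ M = Abs_fps a"
    by (metis mult.assoc mult.commute mult_1 neg_power_series_inverse)
  then show ?thesis
    by (metis fps_nth_Abs_fps times_one_plus_X_power_nth)
qed

lemma strip_binomial: "strip M (\<lambda>k. int (M choose k)) n = (if n = 0 then 1 else 0)"
proof (rule strip_unique)
  fix n
  have "(\<Sum>k\<le>n. (if n - k = 0 then 1 else 0) * int (M choose k)) =
      (\<Sum>k\<le>n. if k = n then int (M choose n) else 0)"
    by (rule sum.cong) auto
  then show "int (M choose n) = (\<Sum>k\<le>n. (if n - k = 0 then 1 else 0) * int (M choose k))"
    by simp
qed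

lemma strip_0 [simp]: "strip M a 0 = a 0"
  by (simp add: strip_def)

section \<open>Greedy coefficients as the solution of a complementarity problem\<close>

lemma greedy_coeff_origin [simp]: "greedy_coeff b c d 0 0 = 1"
  by (simp add: greedy_coeff.simps)

lemma pos_part_eq_nat: "pos_part x = int (nat x)"
  by simp

lemma greedy_coeff_max:
  assumes "(u, v) \<noteq> (0, 0)"
  shows "greedy_coeff b c d u v = max
    (greedy_coeff b c d u v - strip (nat (snd d - c * int v)) (\<lambda>u. greedy_coeff b c d u v) u)
    (greedy_coeff b c d u v - strip (nat (fst d - b * int u)) (greedy_coeff b c d u) v)"
  using assms by (subst greedy_coeff.simps) (simp add: strip_def pos_part_eq_nat)

text \<open>
  The quantity subtracted from \<open>a n\<close> involves earlier values only, which is what makes the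
  recursions well-founded and the inductions below possible.
\<close>

lemma strip_diff_cong:
  assumes "\<And>k. k < n \<Longrightarrow> a k = a' k"
  shows "a n - strip M a n = a' n - strip M a' n"
proof -
  have "(\<Sum>k = 1..n. (-1) ^ (k - 1) * a (n - k) * int_binom (int M + int k - 1) k) =
      (\<Sum>k = 1..n. (-1) ^ (k - 1) * a' (n - k) * int_binom (int M + int k - 1) k)"
    by (rule sum.cong) (auto simp: assms)
  then show ?thesis by (simp add: strip_def)
qed

text \<open>
  Taking the maximum of the two alternating sums says exactly that both stripped values are
  nonnegative and one of them is zero.  This form is symmetric in the two variables and can be
  verified for a candidate array without unfolding the recursion.
\<close>

lemma greedy_coeff_unique:
  assumes origin: "e 0 0 = 1"
    and compl: "\<And>u v. (u, v) \<noteq> (0, 0) \<Longrightarrow>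
      min (strip (nat (snd d - c * int v)) (\<lambda>u. e u v) u)
          (strip (nat (fst d - b * int u)) (e u) v) = 0"
  shows "e u v = greedy_coeff b c d u v"
proof (induction "u + v" arbitrary: u v rule: less_induct)
  case less
  show ?case
  proof (cases "(u, v) = (0, 0)")
    case False
    let ?g = "greedy_coeff b c d"
    have "e u v = max (e u v - strip (nat (snd d - c * int v)) (\<lambda>u. e u v) u)
        (e u v - strip (nat (fst d - b * int u)) (e u) v)"
      using compl[OF False] by linarith
    also have "e u v - strip (nat (snd d - c * int v)) (\<lambda>u. e u v) u =
        ?g u v - strip (nat (snd d - c * int v)) (\<lambda>u. ?g u v) u"
      by (rule strip_diff_cong) (simp add: less)
    also have "e u v - strip (nat (fst d - b * int u)) (e u) v =
        ?g u v - strip (nat (fst d - b * int u)) (?g u) v"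
      by (rule strip_diff_cong) (simp add: less)
    finally show ?thesis
      using greedy_coeff_max[OF False, of b c d] by simp
  qed (simp add: origin)
qed

lemma greedy_coeff_complementary:
  assumes "(u, v) \<noteq> (0, 0)"
  shows "min (strip (nat (snd d - c * int v)) (\<lambda>u. greedy_coeff b c d u v) u)
    (strip (nat (fst d - b * int u)) (greedy_coeff b c d u) v) = 0"
  using greedy_coeff_max[OF assms, of b c d] by linarith

lemma greedy_coeff_swap:
  "greedy_coeff b c (d1, d2) u v = greedy_coeff c b (d2, d1) v u"
proof -
  have "greedy_coeff c b (d2, d1) v u = greedy_coeff b c (d1, d2) u v"
    by (rule greedy_coeff_unique[where e = "\<lambda>u v. greedy_coeff c b (d2, d1) v u"])
      (use greedy_coeff_complementary[of _ _ "(d2, d1)" b c] in \<open>auto simp: min.commute\<close>)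
  then show ?thesis by simp
qed

lemma strip_power_0 [simp]: "strip 0 a n = a n"
proof -
  have "(\<Sum>k = 1..n. (-1) ^ (k - 1) * a (n - k) * int_binom (int 0 + int k - 1) k) = 0"
  proof (rule sum.neutral, rule ballI)
    fix k assume "k \<in> {1..n}"
    then obtain l where "k = Suc l" by (cases k) auto
    then show "(-1) ^ (k - 1) * a (n - k) * int_binom (int 0 + int k - 1) k = 0"
      using rising_binom_Suc[of 0 l] by simp
  qed
  then show ?thesis by (simp add: strip_def)
qed

lemma greedy_coeff_first_column:
  "greedy_coeff b c d u 0 = int (nat (snd d) choose u)"
proof (induction u rule: less_induct)
  case (less u)
  show ?case
  proof (cases "u = 0")
    case False
    let ?g = "\<lambda>u. greedy_coeff b c d u 0"
    have "greedy_coeff b c d u 0 = max (?g u - strip (nat (snd d)) ?g u) 0"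
      using greedy_coeff_max[of u 0 b c d] False by simp
    also have "?g u - strip (nat (snd d)) ?g u = int (nat (snd d) choose u)"
      using strip_diff_cong[of u ?g "\<lambda>k. int (nat (snd d) choose k)" "nat (snd d)"] less False
      by (simp add: strip_binomial)
    finally show ?thesis by simp
  qed simp
qed

lemma greedy_coeff_first_row:
  "greedy_coeff b c d 0 v = int (nat (fst d) choose v)"
  using greedy_coeff_first_column[of c b "prod.swap d" v] greedy_coeff_swap[of b c "fst d" "snd d" 0 v]
  by (simp add: prod.swap_def)

text \<open>
  If \<open>d\<^sub>1 \<le> 0\<close>, then the sums along the rows vanish, so in every column other than the
  first the value \<open>0\<close> reproduces itself.
\<close>

lemma greedy_coeff_nonpos_width:
  assumes "b > 0" and "fst d \<le> 0" and "v > 0"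
  shows "greedy_coeff b c d u v = 0"
proof (induction u rule: less_induct)
  case (less u)
  have "fst d - b * int u \<le> 0"
    using assms by (smt (verit) mult_nonneg_nonneg of_nat_0_le_iff)
  moreover have "greedy_coeff b c d u v - strip M (\<lambda>u. greedy_coeff b c d u v) u = 0" for M
    using strip_diff_cong[of u "\<lambda>u. greedy_coeff b c d u v" "\<lambda>_. 0" M] less
    by (simp add: strip_def)
  ultimately show ?case
    using greedy_coeff_max[of u v b c d] assms(3) by simp
qed

section \<open>Sums over periodic sequences of integers\<close>

lemma sum_int_split_first:
  fixes f :: "int \<Rightarrow> 'a::comm_monoid_add"
  assumes "i \<le> j"
  shows "sum f {i..j} = f i + sum f {i + 1..j}"
proof -
  have "{i..j} = insert i {i + 1..j}" using assms by auto
  then show ?thesis by simp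
qed

lemma sum_int_split:
  fixes f :: "int \<Rightarrow> 'a::comm_monoid_add"
  assumes "i \<le> k" and "k \<le> j + 1"
  shows "sum f {i..j} = sum f {i..k - 1} + sum f {k..j}"
proof -
  have "{i..j} = {i..k - 1} \<union> {k..j}" using assms by auto
  then show ?thesis by (simp add: sum.union_disjoint)
qed

lemma sum_int_telescope:
  fixes F :: "int \<Rightarrow> int"
  assumes "i \<le> j + 1"
  shows "(\<Sum>k = i..j. F (k + 1) - F k) = F (j + 1) - F i"
proof -
  have "(\<Sum>k = i..<i + int m. F (k + 1) - F k) = F (i + int m) - F i" for m
  proof (induction m)
    case (Suc m)
    have "{i..<i + int (Suc m)} = insert (i + int m) {i..<i + int m}" by auto
    then show ?case using Suc by (simp add: algebra_simps)
  qed simp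
  from this[of "nat (j + 1 - i)"] show ?thesis
    using assms by (simp add: atLeastLessThanPlusOne_atLeastAtMost_int)
qed

lemma sum_int_shift:
  fixes f :: "int \<Rightarrow> 'a::comm_monoid_add"
  assumes "\<And>i. f (i + n) = f i"
  shows "sum f {i + n..j + n} = sum f {i..j}"
proof -
  have "f (i - n) = f i" for i
    using assms[of "i - n"] by simp
  then show ?thesis
    by (intro sum.reindex_bij_witness[of _ "\<lambda>i. i + n" "\<lambda>i. i - n"]) auto
qed

lemma sum_int_reflect:
  fixes f :: "int \<Rightarrow> 'a::comm_monoid_add"
  shows "(\<Sum>k = i..j. f (- 1 - k)) = sum f {- 1 - j..- 1 - i}"
  by (rule sum.reindex_bij_witness[of _ "\<lambda>k. - 1 - k" "\<lambda>k. - 1 - k"]) auto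

lemma sum_int_period:
  fixes f :: "int \<Rightarrow> int"
  assumes periodic: "\<And>i. f (i + n) = f i" and "n > 0"
  shows "sum f {i..i + n - 1} = sum f {0..n - 1}"
proof -
  have step: "sum f {i..i + n - 1} = sum f {i + 1..i + n}" for i
    using sum_int_split_first[of i "i + n" f] sum_int_split[of i "i + n" "i + n" f] assms
    by simp
  show ?thesis
  proof (induction i rule: int_induct[where k = 0])
    case (step1 i)
    then show ?case using step[of i] by (simp add: add.commute add.left_commute)
  next
    case (step2 i)
    then show ?case using step[of "i - 1"] by (simp add: algebra_simps)
  qed simp
qed

text \<open>
  A form of the cycle lemma: start where the partial sums attain their minimum over one
  period; later periods can only raise them.
\<close>

lemma periodic_nonneg_forward_sums:
  fixes f :: "int \<Rightarrow> int"
  assumes periodic: "\<And>i. f (i + n) = f i" and "n > 0" and total: "sum f {0..n - 1} \<ge> 0"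
  obtains s where "\<And>j. sum f {s..j} \<ge> 0"
proof -
  define F where "F j = sum f {0..j - 1}" for j
  define s where "s = arg_min_on F {0..n - 1}"
  have s: "s \<in> {0..n - 1}" and s_min: "\<And>j. j \<in> {0..n - 1} \<Longrightarrow> F s \<le> F j"
    unfolding s_def using \<open>n > 0\<close> arg_min_if_finite(1)[of "{0..n - 1}" F]
    by (simp_all add: arg_min_least)
  have F_mono: "F s \<le> F j" if "j \<ge> 0" for j
    using that
  proof (induction "nat j" arbitrary: j rule: less_induct)
    case less
    show ?case
    proof (cases "j < n")
      case False
      have "F j = sum f {0..n - 1} + sum f {n..j - 1}"
        unfolding F_def using False \<open>n > 0\<close> by (intro sum_int_split) auto
      also have "sum f {n..j - 1} = F (j - n)"
        using sum_int_shift[of f n 0 "j - n - 1"] periodic by (simp add: F_def)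
      finally show ?thesis
        using less.hyps[of "j - n"] False \<open>n > 0\<close> total by simp
    qed (use less s_min in auto)
  qed
  have "sum f {s..j} \<ge> 0" for j
  proof (cases "s \<le> j + 1")
    case True
    have "F (j + 1) = F s + sum f {s..j}"
      unfolding F_def using sum_int_split[of 0 s j f] s True by simp
    then show ?thesis using F_mono[of "j + 1"] s True by auto
  qed simp
  then show ?thesis using that by blast
qed

section \<open>Shadows\<close>

text \<open>
  Each position of \<open>S\<close> issues \<open>b\<close> tokens and each position satisfying \<open>P\<close> can absorb one;
  \<open>S\<close> is extended periodically.
\<close>

definition charge :: "int \<Rightarrow> int \<Rightarrow> int set \<Rightarrow> (int \<Rightarrow> bool) \<Rightarrow> int \<Rightarrow> int"
  where "charge b n S P i = (if P i then - 1 else if i mod n \<in> S then b else 0)"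

text \<open>
  Reading backwards, the tokens issued by positions to the right of \<open>i\<close> queue up and are
  absorbed one by one.  A position of charge \<open>-1\<close> is in the shadow iff some token is left for
  it.
\<close>

definition shadow :: "(int \<Rightarrow> int) \<Rightarrow> int set"
  where "shadow f = {i. \<exists>j\<ge>i. 0 \<le> sum f {i..j}}"

text \<open>
  For the least witness \<open>j\<close>, all proper initial sums are negative, so all final sums are
  nonnegative.
\<close>

lemma shadow_suffix_sums:
  assumes "i \<in> shadow f"
  obtains j where "j \<ge> i" and "\<And>k. i \<le> k \<Longrightarrow> k \<le> j \<Longrightarrow> 0 \<le> sum f {k..j}"
proof -
  obtain j0 where j0: "j0 \<ge> i" "0 \<le> sum f {i..j0}"
    using assms by (auto simp: shadow_def)
  define m where "m = (LEAST m. 0 \<le> sum f {i..i + int m})"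
  have m: "0 \<le> sum f {i..i + int m}"
    unfolding m_def by (rule LeastI[of _ "nat (j0 - i)"]) (use j0 in simp)
  have m_min: "sum f {i..i + int m'} < 0" if "m' < m" for m'
    using not_less_Least[of m' "\<lambda>m. 0 \<le> sum f {i..i + int m}"] that by (simp add: m_def)
  have "0 \<le> sum f {k..i + int m}" if "i \<le> k" "k \<le> i + int m" for k
  proof (cases "k = i")
    case False
    have "sum f {i..k - 1} < 0"
      using m_min[of "nat (k - 1 - i)"] that False by simp
    then show ?thesis
      using sum_int_split[of i k "i + int m" f] that m by simp
  qed (use m in simp)
  then show ?thesis using that[of "i + int m"] by simp
qed

lemma periodic_mod:
  fixes n :: int
  assumes "\<And>i. f (i + n) = f i"
  shows "f (i + n * k) = f i"
proof (induction k rule: int_induct[where k = 0])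
  case (step1 k)
  then show ?case using assms[of "i + n * k"] by (simp add: algebra_simps)
next
  case (step2 k)
  then show ?case using assms[of "i + n * (k - 1)"] by (simp add: algebra_simps)
qed simp

lemma shadow_mod:
  assumes "\<And>i. f (i + n) = f i"
  shows "i mod n \<in> shadow f \<longleftrightarrow> i \<in> shadow f"
proof -
  have shift: "i + n * k \<in> shadow f" if "i \<in> shadow f" for i k
  proof -
    obtain j where j: "j \<ge> i" "0 \<le> sum f {i..j}"
      using \<open>i \<in> shadow f\<close> by (auto simp: shadow_def)
    have "sum f {i + n * k..j + n * k} = sum f {i..j}"
      by (rule sum_int_shift) (rule periodic_mod[of f, OF assms])
    then show ?thesis
      unfolding shadow_def using j by (auto intro!: exI[of _ "j + n * k"])
  qed
  show ?thesis
    using shift[of "i mod n" "i div n"] shift[of i "- (i div n)"]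
    by (auto simp: minus_mult_div_eq_mod)
qed

text \<open>
  Let \<open>W j\<close> be the length of the queue of tokens when the backward reading has passed
  position \<open>j\<close>.  If a period has fewer tokens than absorbing positions, then \<open>W\<close>
  is finite and periodic, and \<open>W j - W (j + 1)\<close> is the charge at \<open>j\<close> corrected by \<open>1\<close> at each
  unshadowed absorbing position.  Summing over a period counts those positions.  Otherwise
  a whole period has nonnegative sum, and every position is shadowed.
\<close>

lemma card_unshadowed:
  assumes "n > 0" and "b \<ge> 0" and S: "S \<subseteq> {0..n - 1}" and disj: "\<And>i. i \<in> S \<Longrightarrow> \<not> P i"
    and P: "\<And>i. P (i + n) = P i"
  defines "f \<equiv> charge b n S P"
  shows "card {i \<in> {0..n - 1}. P i \<and> i \<notin> shadow f} =
    nat (int (card {i \<in> {0..n - 1}. P i}) - b * int (card S))"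
proof -
  have periodic: "f (i + n) = f i" for i
    by (simp add: f_def charge_def P)
  define T where "T = sum f {0..n - 1}"
  have T: "T = b * int (card S) - int (card {i \<in> {0..n - 1}. P i})"
  proof -
    have "T = (\<Sum>i = 0..n - 1. (if i \<in> S then b else 0) - (if P i then 1 else 0))"
      unfolding T_def by (rule sum.cong) (auto simp: f_def charge_def disj)
    also have "\<dots> = (\<Sum>i = 0..n - 1. if i \<in> S then b else 0) -
        (\<Sum>i = 0..n - 1. if P i then 1 else 0)"
      by (rule sum_subtractf)
    also have "(\<Sum>i = 0..n - 1. if i \<in> S then b else 0) = b * int (card S)"
      using S by (simp add: sum.If_cases Int_absorb1 mult.commute)
    also have "(\<Sum>i = 0..n - 1. if P i then 1 else 0) = int (card {i \<in> {0..n - 1}. P i})"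
      by (simp add: sum.If_cases Int_def)
    finally show ?thesis .
  qed
  show ?thesis
  proof (cases "T \<ge> 0")
    case True
    have "i \<in> shadow f" for i
      unfolding shadow_def using sum_int_period[of f n i] periodic True \<open>n > 0\<close>
      by (auto simp: T_def intro!: exI[of _ "i + n - 1"])
    then show ?thesis using True T by simp
  next
    case False
    \<comment> \<open>As the total over a period is negative, windows of at most one period attain the
      maximum of all forward sums.\<close>
    define A where "A j m = sum f {j..j + int m - 1}" for j m
    define W where "W j = Max (A j ` {..nat n})" for j
    have A_0: "A j 0 = 0" for j
      by (simp add: A_def)
    have A_Suc: "A j (Suc m) = f j + A (j + 1) m" for j m
      using sum_int_split_first[of j "j + int m" f] by (simp add: A_def)
    have W_ge: "A j m \<le> W j" for j m
    proof (induction m rule: less_induct)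
      case (less m)
      show ?case
      proof (cases "m \<le> nat n")
        case True
        then show ?thesis unfolding W_def by (intro Max_ge) auto
      next
        case False
        have "A j m = sum f {j..j + n - 1} + sum f {j + n..j + int m - 1}"
          unfolding A_def using False \<open>n > 0\<close> by (intro sum_int_split) auto
        also have "sum f {j..j + n - 1} = T"
          unfolding T_def using periodic \<open>n > 0\<close> by (rule sum_int_period)
        also have "sum f {j + n..j + int m - 1} = A j (m - nat n)"
          using sum_int_shift[of f n j "j + int m - 1 - n"] periodic False \<open>n > 0\<close>
          by (simp add: A_def of_nat_diff algebra_simps)
        finally show ?thesis
          using less[of "m - nat n"] False \<open>n > 0\<close> \<open>\<not> T \<ge> 0\<close> by simp
      qed
    qed
    have W_attained: "\<exists>m. W j = A j m" for j
    proof -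
      have "W j \<in> A j ` {..nat n}" unfolding W_def by (rule Max_in) auto
      then show ?thesis by blast
    qed
    have W_nonneg: "0 \<le> W j" for j
      using W_ge[of j 0] by (simp add: A_0)
    have W_rec: "W j = max 0 (f j + W (j + 1))" for j
    proof (rule antisym)
      obtain m where m: "W j = A j m" using W_attained by blast
      show "W j \<le> max 0 (f j + W (j + 1))"
        using W_ge[of "j + 1" "m - 1"] by (cases m) (auto simp: m A_0 A_Suc)
      obtain m where "W (j + 1) = A (j + 1) m" using W_attained by blast
      then show "max 0 (f j + W (j + 1)) \<le> W j"
        using W_ge[of j "Suc m"] W_nonneg[of j] by (simp add: A_Suc)
    qed
    have shadow_iff: "j \<in> shadow f \<longleftrightarrow> 0 \<le> f j + W (j + 1)" for j
    proof
      assume "j \<in> shadow f"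
      then obtain k where k: "k \<ge> j" "0 \<le> sum f {j..k}" by (auto simp: shadow_def)
      then have "0 \<le> A j (Suc (nat (k - j)))" by (simp add: A_def)
      then show "0 \<le> f j + W (j + 1)"
        using W_ge[of "j + 1" "nat (k - j)"] by (simp add: A_Suc)
    next
      assume *: "0 \<le> f j + W (j + 1)"
      obtain m where "W (j + 1) = A (j + 1) m" using W_attained by blast
      with * have "0 \<le> A j (Suc m)" by (simp add: A_Suc)
      then show "j \<in> shadow f"
        by (auto simp: shadow_def A_def intro!: exI[of _ "j + int m"])
    qed
    have drop: "f j + (if P j \<and> j \<notin> shadow f then 1 else 0) = - (W (j + 1) - W j)" for j
    proof (cases "0 \<le> f j + W (j + 1)")
      case True
      then show ?thesis using W_rec[of j] by (simp add: shadow_iff)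
    next
      case False
      then have "f j < 0" using W_nonneg[of "j + 1"] by simp
      then have "P j" "f j = - 1" using \<open>b \<ge> 0\<close> by (auto simp: f_def charge_def split: if_splits)
      then show ?thesis
        using False W_rec[of j] W_nonneg[of "j + 1"] by (simp add: shadow_iff)
    qed
    have "A n m = A 0 m" for m
      using sum_int_shift[of f n 0 "int m - 1"] periodic by (simp add: A_def algebra_simps)
    then have "W n = W 0"
      by (simp add: W_def)
    then have "(\<Sum>j = 0..n - 1. W (j + 1) - W j) = 0"
      using sum_int_telescope[of 0 "n - 1" W] \<open>n > 0\<close> by simp
    then have "0 = (\<Sum>j = 0..n - 1. - (W (j + 1) - W j))"
      using sum_negf[of "\<lambda>j. W (j + 1) - W j" "{0..n - 1}"] by linarith
    also have "\<dots> = (\<Sum>j = 0..n - 1. f j + (if P j \<and> j \<notin> shadow f then 1 else 0))"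
      by (rule sum.cong[OF refl]) (rule drop[symmetric])
    also have "\<dots> = T + (\<Sum>j = 0..n - 1. if P j \<and> j \<notin> shadow f then 1 else 0)"
      by (simp only: sum.distrib T_def)
    also have "(\<Sum>j = 0..n - 1. if P j \<and> j \<notin> shadow f then 1 else 0) =
        int (card {i \<in> {0..n - 1}. P i \<and> i \<notin> shadow f})"
      by (simp add: sum.If_cases Int_def)
    finally have "int (card {i \<in> {0..n - 1}. P i \<and> i \<notin> shadow f}) =
        int (card {i \<in> {0..n - 1}. P i}) - b * int (card S)"
      using T by linarith
    then show ?thesis by (metis nat_int)
  qed
qed

section \<open>Compatible pairs on a cyclic Christoffel word\<close>

text \<open>
  The word has period \<open>d1 + d2\<close>; position \<open>i\<close> is a horizontal step if this holds and a
  vertical step otherwise.  It is the periodic Christoffel word of slope \<open>d2 / d1\<close> (repeated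
  when \<open>d1\<close> and \<open>d2\<close> have a common factor), that is, the lattice path running as closely as
  possible below the diagonal.
\<close>

definition horiz :: "int \<Rightarrow> int \<Rightarrow> int \<Rightarrow> bool"
  where "horiz d1 d2 i \<longleftrightarrow> (i * d2) mod (d1 + d2) < d1"

text \<open>
  The distance of the path below the diagonal before step \<open>i\<close>, scaled so that a horizontal step
  counts \<open>d2\<close> and a vertical step \<open>- d1\<close>.
\<close>

definition height :: "int \<Rightarrow> int \<Rightarrow> int \<Rightarrow> int"
  where "height d1 d2 i = (i * d2) mod (d1 + d2)"

definition h_edges :: "int \<Rightarrow> int \<Rightarrow> int set"
  where "h_edges d1 d2 = {i \<in> {0..d1 + d2 - 1}. horiz d1 d2 i}"

definition v_edges :: "int \<Rightarrow> int \<Rightarrow> int set"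
  where "v_edges d1 d2 = {i \<in> {0..d1 + d2 - 1}. \<not> horiz d1 d2 i}"

definition h_charge :: "int \<Rightarrow> int \<Rightarrow> int \<Rightarrow> int set \<Rightarrow> int \<Rightarrow> int"
  where "h_charge b d1 d2 S = charge b (d1 + d2) S (horiz d1 d2)"

definition v_charge :: "int \<Rightarrow> int \<Rightarrow> int \<Rightarrow> int set \<Rightarrow> int \<Rightarrow> int"
  where "v_charge c d1 d2 S = charge c (d1 + d2) S (\<lambda>i. \<not> horiz d1 d2 i)"

text \<open>
  An interval is a clash if the tokens issued by the vertical edges in it, sent to the left,
  last for all its horizontal edges, and at the same time the tokens issued by the horizontal
  edges in it, sent to the right, last for all its vertical edges.
\<close>

definition clash :: "(int \<Rightarrow> int) \<Rightarrow> (int \<Rightarrow> int) \<Rightarrow> int \<Rightarrow> int \<Rightarrow> bool"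
  where "clash f g i j \<longleftrightarrow>
    i \<le> j \<and> (\<forall>k. i \<le> k \<and> k \<le> j \<longrightarrow> 0 \<le> sum f {k..j} \<and> 0 \<le> sum g {i..k})"

text \<open>
  This is a reformulation, by partial sums on the periodic word, of the compatible pairs of
  edges of a maximal Dyck path due to Lee, Li and Zelevinsky.  Quantifying over all
  intervals, rather than over those from a chosen horizontal to a chosen vertical edge, makes
  reversal of the word a symmetry of the definition by inspection.
\<close>

definition compatible :: "int \<Rightarrow> int \<Rightarrow> int \<Rightarrow> int \<Rightarrow> int set \<Rightarrow> int set \<Rightarrow> bool"
  where "compatible b c d1 d2 S1 S2 \<longleftrightarrow>
    (\<forall>i j. \<not> clash (h_charge b d1 d2 S2) (v_charge c d1 d2 S1) i j)"

text \<open>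
  The number \<open>u\<close> counts vertical and \<open>v\<close> counts horizontal edges, matching the arguments of
  \<open>greedy_coeff\<close>.
\<close>

definition pairs :: "int \<Rightarrow> int \<Rightarrow> int \<Rightarrow> int \<Rightarrow> nat \<Rightarrow> nat \<Rightarrow> (int set \<times> int set) set"
  where "pairs b c d1 d2 u v = {(S1, S2). S1 \<subseteq> h_edges d1 d2 \<and> S2 \<subseteq> v_edges d1 d2 \<and>
    card S2 = u \<and> card S1 = v \<and> compatible b c d1 d2 S1 S2}"

definition shadowed_pairs ::
    "int \<Rightarrow> int \<Rightarrow> int \<Rightarrow> int \<Rightarrow> nat \<Rightarrow> nat \<Rightarrow> (int set \<times> int set) set"
  where "shadowed_pairs b c d1 d2 u v =
    {(S1, S2) \<in> pairs b c d1 d2 u v. S1 \<subseteq> shadow (h_charge b d1 d2 S2)}"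

lemma finite_h_edges [simp]: "finite (h_edges d1 d2)"
  and finite_v_edges [simp]: "finite (v_edges d1 d2)"
  by (rule finite_subset[of _ "{0..d1 + d2 - 1}"]; auto simp: h_edges_def v_edges_def)+

lemma finite_pairs [simp]: "finite (pairs b c d1 d2 u v)"
  by (rule finite_subset[of _ "Pow (h_edges d1 d2) \<times> Pow (v_edges d1 d2)"])
    (auto simp: pairs_def)

lemma finite_shadowed_pairs [simp]: "finite (shadowed_pairs b c d1 d2 u v)"
  by (rule finite_subset[of _ "pairs b c d1 d2 u v"]) (auto simp: shadowed_pairs_def)

lemma horiz_periodic: "horiz d1 d2 (i + (d1 + d2)) = horiz d1 d2 i"
  by (simp only: horiz_def distrib_right[of i] mod_mult_self2)

lemma horiz_mod: "horiz d1 d2 (i mod (d1 + d2)) = horiz d1 d2 i"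
  by (simp add: horiz_def mod_mult_left_eq)

lemma h_charge_periodic: "h_charge b d1 d2 S (i + (d1 + d2)) = h_charge b d1 d2 S i"
  by (simp add: h_charge_def charge_def horiz_periodic)

lemma height_step:
  assumes "d1 > 0" and "d2 > 0"
  shows "height d1 d2 (i + 1) - height d1 d2 i = (if horiz d1 d2 i then d2 else - d1)"
proof -
  let ?n = "d1 + d2" and ?r = "(i * d2) mod (d1 + d2)"
  have r: "0 \<le> ?r" "?r < ?n" using assms by auto
  have eq: "height d1 d2 (i + 1) = (?r + d2) mod ?n"
    by (simp add: height_def distrib_right mod_add_left_eq)
  show ?thesis
  proof (cases "?r < d1")
    case True
    then have "(?r + d2) mod ?n = ?r + d2"
      using r assms by (intro mod_pos_pos_trivial) auto
    then show ?thesis using True unfolding eq by (simp add: height_def horiz_def)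
  next
    case False
    have "(?r + d2) mod ?n = (?r + d2 - ?n) mod ?n"
      by (rule minus_mod_self2[symmetric])
    also have "\<dots> = ?r + d2 - ?n"
      by (rule mod_pos_pos_trivial) (use r assms False in linarith)+
    finally show ?thesis using False unfolding eq by (simp add: height_def horiz_def)
  qed
qed

text \<open>
  The height returns to its value after a period, so \<open>d2\<close> times the number of horizontal edges
  is \<open>d1\<close> times the number of vertical ones.
\<close>

lemma card_h_edges:
  assumes "d1 > 0" and "d2 > 0"
  shows "int (card (h_edges d1 d2)) = d1"
proof -
  let ?n = "d1 + d2" and ?x = "int (card (h_edges d1 d2))"
  have "0 = height d1 d2 ?n - height d1 d2 0"
    by (simp add: height_def)
  also have "\<dots> = (\<Sum>i = 0..?n - 1. if horiz d1 d2 i then d2 else - d1)"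
    using sum_int_telescope[of 0 "?n - 1" "height d1 d2"] assms by (simp add: height_step)
  also have "\<dots> = (\<Sum>i = 0..?n - 1. (if horiz d1 d2 i then ?n else 0) - d1)"
    by (rule sum.cong) auto
  also have "\<dots> = ?n * ?x - ?n * d1"
    using assms by (simp add: sum_subtractf sum.If_cases Int_def h_edges_def mult.commute)
  finally show ?thesis using assms by simp
qed

section \<open>Reversing the word\<close>

definition flip :: "int \<Rightarrow> int \<Rightarrow> int"
  where "flip n i = n - 1 - i"

lemma flip_flip [simp]: "flip n (flip n i) = i" "flip n ` flip n ` S = S"
  by (simp_all add: flip_def image_image)

lemma inj_flip: "inj_on (flip n) S"
  by (auto simp: flip_def inj_on_def)

lemma mod_reflect:
  assumes "(n :: int) > 0"
  shows "(- 1 - i) mod n = flip n (i mod n)"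
proof -
  have "- 1 - i = flip n (i mod n) + n * (- 1 - i div n)"
    using mult_div_mod_eq[of n i] by (simp add: flip_def algebra_simps)
  then have "(- 1 - i) mod n = flip n (i mod n) mod n"
    by simp
  also have "\<dots> = flip n (i mod n)"
    using assms pos_mod_bound[OF assms, of i] pos_mod_sign[OF assms, of i]
    by (intro mod_pos_pos_trivial) (simp_all add: flip_def)
  finally show ?thesis .
qed

text \<open>
  Modulo \<open>d1 + d2\<close>, multiplication by \<open>d2\<close> is multiplication by \<open>- d1\<close>.  Hence the reversed
  word, with horizontal and vertical steps exchanged, is the word for \<open>(d2, d1)\<close>.
\<close>

lemma horiz_reflect:
  assumes "d1 > 0" and "d2 > 0"
  shows "horiz d1 d2 (- 1 - i) \<longleftrightarrow> \<not> horiz d2 d1 i"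
proof -
  let ?n = "d1 + d2"
  have "((- 1 - i) * d2) mod ?n = ((i + 1) * d1) mod ?n"
  proof -
    have "(- 1 - i) * d2 = (i + 1) * d1 + ?n * (- 1 - i)" by algebra
    then show ?thesis by (metis mod_mult_self2)
  qed
  then have "horiz d1 d2 (- 1 - i) \<longleftrightarrow> height d2 d1 (i + 1) < d1"
    by (simp add: horiz_def height_def add.commute)
  also have "\<dots> \<longleftrightarrow> \<not> horiz d2 d1 i"
  proof -
    have "0 \<le> height d2 d1 i" "height d2 d1 i < ?n"
      using assms by (simp_all add: height_def add.commute)
    then show ?thesis
      using height_step[OF assms(2,1), of i] unfolding horiz_def height_def
      by (auto split: if_splits)
  qed
  finally show ?thesis .
qed

lemma charge_reflect:
  assumes "d1 > 0" and "d2 > 0"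
  shows "h_charge b d2 d1 (flip (d1 + d2) ` S) i = v_charge b d1 d2 S (- 1 - i)"
    and "v_charge b d2 d1 (flip (d1 + d2) ` S) i = h_charge b d1 d2 S (- 1 - i)"
proof -
  have "i mod (d2 + d1) \<in> flip (d1 + d2) ` S \<longleftrightarrow> (- 1 - i) mod (d1 + d2) \<in> S"
    using assms mod_reflect[of "d1 + d2" i] flip_flip
    by (auto simp: add.commute image_iff intro!: bexI[of _ "flip (d1 + d2) (i mod (d1 + d2))"])
  then show "h_charge b d2 d1 (flip (d1 + d2) ` S) i = v_charge b d1 d2 S (- 1 - i)"
    and "v_charge b d2 d1 (flip (d1 + d2) ` S) i = h_charge b d1 d2 S (- 1 - i)"
    using horiz_reflect[OF assms, of i]
    by (simp_all add: h_charge_def v_charge_def charge_def)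
qed

lemma compatible_flip:
  assumes "d1 > 0" and "d2 > 0" and "compatible b c d1 d2 S1 S2"
  shows "compatible c b d2 d1 (flip (d1 + d2) ` S2) (flip (d1 + d2) ` S1)"
  unfolding compatible_def
proof (intro allI notI)
  fix i j
  let ?f = "h_charge b d1 d2 S2" and ?g = "v_charge c d1 d2 S1"
  let ?f' = "h_charge c d2 d1 (flip (d1 + d2) ` S1)"
  let ?g' = "v_charge b d2 d1 (flip (d1 + d2) ` S2)"
  assume *: "clash ?f' ?g' i j"
  have f': "sum ?f' {k..l} = sum ?g {- 1 - l..- 1 - k}"
    and g': "sum ?g' {k..l} = sum ?f {- 1 - l..- 1 - k}" for k l
    by (simp_all add: charge_reflect[OF assms(1,2)] sum_int_reflect)
  have "clash ?f ?g (- 1 - j) (- 1 - i)"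
    unfolding clash_def
  proof (intro conjI allI impI)
    fix k assume "- 1 - j \<le> k \<and> k \<le> - 1 - i"
    then have "i \<le> - 1 - k" "- 1 - k \<le> j" by auto
    with * have "0 \<le> sum ?f' {- 1 - k..j}" "0 \<le> sum ?g' {i..- 1 - k}"
      by (auto simp: clash_def)
    then show "0 \<le> sum ?f {k..- 1 - i}" "0 \<le> sum ?g {- 1 - j..k}"
      by (simp_all add: f' g')
  qed (use * in \<open>simp add: clash_def\<close>)
  then show False using assms(3) by (simp add: compatible_def)
qed

lemma edges_flip:
  assumes "d1 > 0" and "d2 > 0"
  shows "S \<subseteq> h_edges d1 d2 \<Longrightarrow> flip (d1 + d2) ` S \<subseteq> v_edges d2 d1"
    and "S \<subseteq> v_edges d1 d2 \<Longrightarrow> flip (d1 + d2) ` S \<subseteq> h_edges d2 d1"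
proof -
  have *: "flip (d1 + d2) i \<in> {0..d2 + d1 - 1} \<and> (horiz d2 d1 (flip (d1 + d2) i) \<longleftrightarrow> \<not> horiz d1 d2 i)"
    if "i \<in> {0..d1 + d2 - 1}" for i
  proof -
    have "horiz d2 d1 (flip (d1 + d2) i) \<longleftrightarrow> horiz d2 d1 (- 1 - i)"
      using horiz_periodic[of d2 d1 "- 1 - i"] by (simp add: flip_def algebra_simps)
    then show ?thesis using horiz_reflect[OF assms(2,1), of i] that by (auto simp: flip_def)
  qed
  show "S \<subseteq> h_edges d1 d2 \<Longrightarrow> flip (d1 + d2) ` S \<subseteq> v_edges d2 d1"
    and "S \<subseteq> v_edges d1 d2 \<Longrightarrow> flip (d1 + d2) ` S \<subseteq> h_edges d2 d1"
    using * unfolding h_edges_def v_edges_def by blast+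
qed

lemma card_pairs_flip:
  assumes "d1 > 0" and "d2 > 0"
  shows "card (pairs b c d1 d2 u v) = card (pairs c b d2 d1 v u)"
proof (rule bij_betw_same_card)
  let ?F = "\<lambda>(S1, S2). (flip (d1 + d2) ` S2, flip (d1 + d2) ` S1)"
  have "?F (S1, S2) \<in> pairs c b d2 d1 v u" if "(S1, S2) \<in> pairs b c d1 d2 u v" for S1 S2
    using that edges_flip[OF assms, of S1] edges_flip[OF assms, of S2]
      compatible_flip[OF assms, of b c S1 S2]
    by (simp add: pairs_def card_image inj_flip)
  moreover have "?F (S1, S2) \<in> pairs b c d1 d2 u v" if "(S1, S2) \<in> pairs c b d2 d1 v u" for S1 S2
    using that edges_flip[OF assms(2,1), of S1] edges_flip[OF assms(2,1), of S2]
      compatible_flip[OF assms(2,1), of c b S1 S2]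
    by (simp add: pairs_def card_image inj_flip add.commute)
  ultimately show "bij_betw ?F (pairs b c d1 d2 u v) (pairs c b d2 d1 v u)"
    by (intro bij_betwI[of _ _ _ ?F]) auto
qed

section \<open>Counting compatible pairs\<close>

lemma clash_cong:
  assumes "\<And>k. i \<le> k \<Longrightarrow> k \<le> j \<Longrightarrow> g k = g' k" and "clash f g i j"
  shows "clash f g' i j"
proof -
  have "sum g {i..k} = sum g' {i..k}" if "k \<le> j" for k
    using that by (intro sum.cong) (auto intro: assms(1))
  then show ?thesis using assms(2) by (simp add: clash_def)
qed

text \<open>
  In a clash every horizontal edge lies in the shadow of \<open>S2\<close>, so the edges of \<open>S1\<close> outside
  the shadow have no influence on compatibility.
\<close>

lemma compatible_shadow_iff:
  "compatible b c d1 d2 S1 S2 \<longleftrightarrow>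
    compatible b c d1 d2 (S1 \<inter> shadow (h_charge b d1 d2 S2)) S2"
proof -
  let ?f = "h_charge b d1 d2 S2"
  have eq: "v_charge c d1 d2 S1 k = v_charge c d1 d2 (S1 \<inter> shadow ?f) k"
    if "i \<le> k" "k \<le> j" "\<And>l. i \<le> l \<Longrightarrow> l \<le> j \<Longrightarrow> 0 \<le> sum ?f {l..j}" for i j k
  proof -
    have "k \<in> shadow ?f" using that by (auto simp: shadow_def)
    then have "k mod (d1 + d2) \<in> shadow ?f"
      using shadow_mod[of ?f "d1 + d2" k] h_charge_periodic by blast
    then show ?thesis by (simp add: v_charge_def charge_def)
  qed
  have "clash ?f (v_charge c d1 d2 S1) i j \<longleftrightarrow>
      clash ?f (v_charge c d1 d2 (S1 \<inter> shadow ?f)) i j" for i j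
  proof
    assume *: "clash ?f (v_charge c d1 d2 S1) i j"
    show "clash ?f (v_charge c d1 d2 (S1 \<inter> shadow ?f)) i j"
      by (rule clash_cong[OF eq *]) (use * in \<open>auto simp: clash_def\<close>)
  next
    assume *: "clash ?f (v_charge c d1 d2 (S1 \<inter> shadow ?f)) i j"
    show "clash ?f (v_charge c d1 d2 S1) i j"
      by (rule clash_cong[OF eq[symmetric] *]) (use * in \<open>auto simp: clash_def\<close>)
  qed
  then show ?thesis by (simp add: compatible_def)
qed

lemma card_free_edges:
  assumes "b > 0" and "d1 > 0" and "d2 > 0" and "S2 \<subseteq> v_edges d1 d2"
  shows "card (h_edges d1 d2 - shadow (h_charge b d1 d2 S2)) = nat (d1 - b * int (card S2))"
proof -
  have "h_edges d1 d2 - shadow (h_charge b d1 d2 S2) =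
      {i \<in> {0..d1 + d2 - 1}. horiz d1 d2 i \<and> i \<notin> shadow (charge b (d1 + d2) S2 (horiz d1 d2))}"
    by (auto simp: h_edges_def h_charge_def)
  also have "card \<dots> = nat (int (card (h_edges d1 d2)) - b * int (card S2))"
    unfolding h_edges_def using assms
    by (intro card_unshadowed) (auto simp: v_edges_def horiz_periodic)
  finally show ?thesis using card_h_edges[OF assms(2,3)] by simp
qed

text \<open>
  Once \<open>S2\<close> and the shadowed part of \<open>S1\<close> are fixed, the rest of \<open>S1\<close> is an arbitrary set
  of unshadowed horizontal edges, of which there are \<open>[d1 - b u]\<^sub>+\<close>.  In terms of generating
  functions, row \<open>u\<close> is divisible by \<open>(1 + X)\<close> to that power, with a nonnegative quotient.
\<close>

lemma card_pairs_eq_sum: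
  assumes "b > 0" and "d1 > 0" and "d2 > 0"
  shows "card (pairs b c d1 d2 u v) =
    (\<Sum>k\<le>v. card (shadowed_pairs b c d1 d2 u (v - k)) * (nat (d1 - b * int u) choose k))"
proof -
  let ?sh = "\<lambda>S2. shadow (h_charge b d1 d2 S2)"
  define Q where "Q k = {(S1, S2) \<in> pairs b c d1 d2 u v. card (S1 - ?sh S2) = k}" for k
  have "pairs b c d1 d2 u v = (\<Union>k\<le>v. Q k)"
  proof -
    have "card (S1 - ?sh S2) \<le> v" if "(S1, S2) \<in> pairs b c d1 d2 u v" for S1 S2
      using that by (auto simp: pairs_def intro!: card_mono intro: finite_subset)
    then show ?thesis by (auto simp: Q_def)
  qed
  moreover have "finite (Q k)" for k
    by (rule finite_subset[OF _ finite_pairs[of b c d1 d2 u v]]) (auto simp: Q_def)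
  moreover have "Q k \<inter> Q l = {}" if "k \<noteq> l" for k l
    using that by (auto simp: Q_def)
  ultimately have "card (pairs b c d1 d2 u v) = (\<Sum>k\<le>v. card (Q k))"
    using card_UN_disjoint[of "{..v}" Q] by simp
  also have "\<dots> =
      (\<Sum>k\<le>v. card (shadowed_pairs b c d1 d2 u (v - k)) * (nat (d1 - b * int u) choose k))"
  proof (rule sum.cong)
    fix k assume "k \<in> {..v}"
    then have "k \<le> v" by simp
    let ?B = "\<lambda>p. {B. B \<subseteq> h_edges d1 d2 - ?sh (snd p) \<and> card B = k}"
    let ?R = "SIGMA p : shadowed_pairs b c d1 d2 u (v - k). ?B p"
    have fwd: "((S1 \<inter> ?sh S2, S2), S1 - ?sh S2) \<in> ?R" if *: "(S1, S2) \<in> Q k" for S1 S2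
    proof -
      have "finite S1"
        using * by (auto simp: Q_def pairs_def intro: finite_subset)
      then have "card (S1 \<inter> ?sh S2) = v - k"
        using * card_Int_Diff[of S1 "?sh S2"] by (auto simp: Q_def pairs_def)
      then show ?thesis
        using * compatible_shadow_iff[of b c d1 d2 S1 S2]
        by (auto simp: Q_def pairs_def shadowed_pairs_def)
    qed
    have bwd: "(A \<union> B, S2) \<in> Q k" if "((A, S2), B) \<in> ?R" for A S2 B
    proof -
      have AB: "A \<subseteq> ?sh S2" "A \<subseteq> h_edges d1 d2" "compatible b c d1 d2 A S2"
          "S2 \<subseteq> v_edges d1 d2" "card S2 = u" "card A = v - k"
          "B \<subseteq> h_edges d1 d2 - ?sh S2" "card B = k"
        using that by (auto simp: shadowed_pairs_def pairs_def)
      have "finite A" "finite B" "A \<inter> B = {}"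
        using AB by (auto intro: finite_subset[OF _ finite_h_edges[of d1 d2]])
      then have "card (A \<union> B) = v"
        using AB \<open>k \<le> v\<close> by (simp add: card_Un_disjoint)
      moreover have "(A \<union> B) \<inter> ?sh S2 = A" "(A \<union> B) - ?sh S2 = B"
        using AB by auto
      ultimately show ?thesis
        using AB compatible_shadow_iff[of b c d1 d2 "A \<union> B" S2]
        by (auto simp: Q_def pairs_def)
    qed
    have "bij_betw (\<lambda>(S1, S2). ((S1 \<inter> ?sh S2, S2), S1 - ?sh S2)) (Q k) ?R"
    proof (rule bij_betw_byWitness[where f' = "\<lambda>((A, S2), B). (A \<union> B, S2)"])
      show "(\<lambda>(S1, S2). ((S1 \<inter> ?sh S2, S2), S1 - ?sh S2)) ` Q k \<subseteq> ?R"
        by (rule image_subsetI) (use fwd in \<open>simp add: case_prod_beta del: mem_Sigma_iff\<close>)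
      show "(\<lambda>((A, S2), B). (A \<union> B, S2)) ` ?R \<subseteq> Q k"
        by (rule image_subsetI) (use bwd in \<open>simp add: case_prod_beta del: mem_Sigma_iff\<close>)
    qed (auto simp: shadowed_pairs_def)
    then have "card (Q k) = card ?R"
      by (rule bij_betw_same_card)
    also have "\<dots> = (\<Sum>p \<in> shadowed_pairs b c d1 d2 u (v - k). card (?B p))"
      by (intro card_SigmaI) auto
    also have "\<dots> = (\<Sum>p \<in> shadowed_pairs b c d1 d2 u (v - k). nat (d1 - b * int u) choose k)"
    proof (rule sum.cong)
      fix p assume "p \<in> shadowed_pairs b c d1 d2 u (v - k)"
      then show "card (?B p) = nat (d1 - b * int u) choose k"
        using card_free_edges[OF assms, of "snd p"]
        by (auto simp: shadowed_pairs_def pairs_def n_subsets)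
    qed simp
    finally show "card (Q k) =
        card (shadowed_pairs b c d1 d2 u (v - k)) * (nat (d1 - b * int u) choose k)"
      by simp
  qed simp
  finally show ?thesis .
qed

lemma strip_card_pairs:
  assumes "b > 0" and "d1 > 0" and "d2 > 0"
  shows "strip (nat (d1 - b * int u)) (\<lambda>v. int (card (pairs b c d1 d2 u v))) v =
    int (card (shadowed_pairs b c d1 d2 u v))"
  by (rule strip_unique) (simp add: card_pairs_eq_sum[OF assms])

text \<open>
  Without a clash, the running sum of \<open>g\<close> from any starting point of the interval becomes
  negative within the interval; restarting after that point cuts the interval into pieces of
  negative sum.
\<close>

lemma no_clash_imp_neg_sum:
  assumes f: "\<And>k. i \<le> k \<Longrightarrow> k \<le> j \<Longrightarrow> 0 \<le> sum f {k..j}"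
    and no_clash: "\<And>i j. \<not> clash f g i j" and "i \<le> j"
  shows "sum g {i..j} < 0"
  using f \<open>i \<le> j\<close>
proof (induction "nat (j - i)" arbitrary: i rule: less_induct)
  case less
  obtain k where k: "i \<le> k" "k \<le> j" "sum g {i..k} < 0"
    using no_clash[of i j] less.prems by (force simp: clash_def)
  show ?case
  proof (cases "k = j")
    case False
    have "sum g {k + 1..j} < 0"
      by (rule less.hyps) (use k False less.prems in auto)
    then show ?thesis
      using sum_int_split[of i "k + 1" j g] k by simp
  qed (use k in simp)
qed

text \<open>
  This is where the shape of the path matters.  Consider an interval that starts at an edge of
  \<open>S1\<close> and ends where the tokens shadowing it originate.  Compatibility makes \<open>c\<close> times the
  number of edges of \<open>S1\<close> in it less than the number of its vertical edges, and \<open>b\<close> times the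
  number of edges of \<open>S2\<close> is at least the number of its horizontal edges.  Since the
  interval begins with a horizontal step, the path gains less than one vertical step on the
  diagonal over it, so the weight \<open>w\<close>, which is
  \<open>c d1\<close> on \<open>S1\<close> and \<open>- b d2\<close> on \<open>S2\<close>, has negative sum over the interval.  If its sum over
  a period were nonnegative, then all sums from some point on would be nonnegative, contrary to
  the interval starting at the next edge of \<open>S1\<close>.
\<close>

lemma shadowed_pairs_below_diagonal:
  assumes "b > 0" and "c > 0" and "d1 > 0" and "d2 > 0"
    and "(S1, S2) \<in> shadowed_pairs b c d1 d2 u v" and "(u, v) \<noteq> (0, 0)"
  shows "c * d1 * int v < b * d2 * int u"
proof (cases "v = 0")
  case True
  then show ?thesis using assms by simp
next
  case False
  let ?n = "d1 + d2" and ?f = "h_charge b d1 d2 S2" and ?g = "v_charge c d1 d2 S1"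
  have S: "S1 \<subseteq> h_edges d1 d2" "S2 \<subseteq> v_edges d1 d2" "card S2 = u" "card S1 = v"
      "S1 \<subseteq> shadow ?f" and no_clash: "\<And>i j. \<not> clash ?f ?g i j"
    using assms(5) by (auto simp: shadowed_pairs_def pairs_def compatible_def)
  \<comment> \<open>In this form the sum over an interval is read off from the two charges and the
    telescoping heights; the next fact identifies it as the weight of \<open>S1\<close> and \<open>S2\<close>.\<close>
  define w where "w i = d1 * ?g i - d2 * ?f i - (height d1 d2 (i + 1) - height d1 d2 i)" for i
  have w: "w i = (if i mod ?n \<in> S1 then c * d1 else 0) - (if i mod ?n \<in> S2 then b * d2 else 0)"
    for i
  proof -
    have "horiz d1 d2 i" if "i mod ?n \<in> S1"
      using that S(1) horiz_mod[of d1 d2 i] by (auto simp: h_edges_def)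
    moreover have "\<not> horiz d1 d2 i" if "i mod ?n \<in> S2"
      using that S(2) horiz_mod[of d1 d2 i] by (auto simp: v_edges_def)
    ultimately show ?thesis
      by (auto simp: w_def height_step[OF assms(3,4)] h_charge_def v_charge_def charge_def)
  qed
  have total: "sum w {0..?n - 1} = c * d1 * int v - b * d2 * int u"
  proof -
    have "sum w {0..?n - 1} = (\<Sum>i = 0..?n - 1. (if i \<in> S1 then c * d1 else 0) -
        (if i \<in> S2 then b * d2 else 0))"
      by (rule sum.cong) (auto simp: w)
    also have "\<dots> = c * d1 * int v - b * d2 * int u"
    proof -
      have "{0..?n - 1} \<inter> S1 = S1" "{0..?n - 1} \<inter> S2 = S2"
        using S by (auto simp: h_edges_def v_edges_def)
      then show ?thesis
        using S by (simp add: sum_subtractf sum.If_cases mult.commute)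
    qed
    finally show ?thesis .
  qed
  have interval: "sum w {i..j} < 0"
    if "horiz d1 d2 i" "i \<le> j" "\<And>k. i \<le> k \<Longrightarrow> k \<le> j \<Longrightarrow> 0 \<le> sum ?f {k..j}" for i j
  proof -
    have "sum ?g {i..j} < 0"
      using no_clash_imp_neg_sum[of i j ?f ?g] that no_clash by blast
    then have "d1 * sum ?g {i..j} \<le> d1 * - 1"
      using \<open>d1 > 0\<close> by (intro mult_left_mono) auto
    moreover have "0 \<le> d2 * sum ?f {i..j}"
      using that \<open>d2 > 0\<close> by simp
    moreover have "height d1 d2 i < d1" "0 \<le> height d1 d2 (j + 1)"
      using that(1) assms by (simp_all add: height_def horiz_def)
    moreover have "sum w {i..j} = d1 * sum ?g {i..j} - d2 * sum ?f {i..j} -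
        (height d1 d2 (j + 1) - height d1 d2 i)"
      using sum_int_telescope[of i j "height d1 d2"] that(2)
      by (simp add: w_def sum_subtractf sum_distrib_left)
    ultimately show ?thesis by simp
  qed
  show ?thesis
  proof (rule ccontr)
    assume "\<not> ?thesis"
    then have "sum w {0..?n - 1} \<ge> 0" "?n > 0" using assms by (simp_all add: total)
    moreover have "w (i + ?n) = w i" for i
      by (simp add: w)
    ultimately obtain s where s: "\<And>j. sum w {s..j} \<ge> 0"
      using periodic_nonneg_forward_sums[of w ?n] by blast
    obtain a where "a \<in> S1"
      using False S(4) by fastforce
    \<comment> \<open>The first edge of \<open>S1\<close> from \<open>s\<close> on; before it, \<open>w\<close> is at most \<open>0\<close>.\<close>
    define M where "M = (LEAST m. (s + int m) mod ?n \<in> S1)"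
    have "(s + int (nat ((a - s) mod ?n))) mod ?n \<in> S1"
    proof -
      have "int (nat ((a - s) mod ?n)) = (a - s) mod ?n"
        using assms by simp
      then have "(s + int (nat ((a - s) mod ?n))) mod ?n = a mod ?n"
        by (simp add: mod_add_right_eq)
      then show ?thesis
        using \<open>a \<in> S1\<close> S(1) by (auto simp: h_edges_def)
    qed
    then have M: "(s + int M) mod ?n \<in> S1"
      unfolding M_def by (rule LeastI)
    have before: "w i \<le> 0" if "i \<in> {s..s + int M - 1}" for i
    proof -
      have "nat (i - s) < M"
        using that by auto
      then have "(s + int (nat (i - s))) mod ?n \<notin> S1"
        unfolding M_def by (rule not_less_Least)
      then show ?thesis
        using that assms by (auto simp: w)
    qed
    have "(s + int M) mod ?n \<in> shadow ?f"
      using M S(5) by auto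
    then have "s + int M \<in> shadow ?f"
      using shadow_mod[of ?f ?n] h_charge_periodic by blast
    then obtain j where j: "j \<ge> s + int M"
        "\<And>k. s + int M \<le> k \<Longrightarrow> k \<le> j \<Longrightarrow> 0 \<le> sum ?f {k..j}"
      by (rule shadow_suffix_sums) blast
    have "horiz d1 d2 (s + int M)"
      using M S(1) horiz_mod[of d1 d2 "s + int M"] by (auto simp: h_edges_def)
    then have "sum w {s + int M..j} < 0"
      using j by (intro interval)
    moreover have "sum w {s..s + int M - 1} \<le> 0"
      using before by (rule sum_nonpos)
    ultimately show False
      using s[of j] sum_int_split[of s "s + int M" j w] j(1) by simp
  qed
qed

text \<open>
  With both sets empty no tokens are issued.  A clash would have to start with a horizontal edge,
  and there is no token to absorb for it.
\<close>

lemma pairs_origin: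
  assumes "d1 > 0" and "d2 > 0"
  shows "pairs b c d1 d2 0 0 = {({}, {})}"
proof -
  have "\<not> clash (h_charge b d1 d2 {}) (v_charge c d1 d2 {}) i j" for i j
  proof
    let ?f = "h_charge b d1 d2 {}" and ?g = "v_charge c d1 d2 {}"
    assume "clash ?f ?g i j"
    then have ij: "i \<le> j" and "0 \<le> sum ?g {i..i}" "0 \<le> sum ?f {i..j}"
      by (auto simp: clash_def)
    then have "horiz d1 d2 i"
      by (auto simp: v_charge_def charge_def split: if_splits)
    moreover have "sum ?f {i + 1..j} \<le> 0"
      by (intro sum_nonpos) (auto simp: h_charge_def charge_def)
    ultimately show False
      using sum_int_split_first[OF ij, of ?f] \<open>0 \<le> sum ?f {i..j}\<close>
      by (simp add: h_charge_def charge_def)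
  qed
  then have "compatible b c d1 d2 {} {}"
    by (simp add: compatible_def)
  then show ?thesis
    by (auto simp: pairs_def card_eq_0_iff dest: finite_subset[OF _ finite_h_edges]
        finite_subset[OF _ finite_v_edges])
qed

text \<open>
  Stripping a row leaves the compatible pairs with \<open>S1\<close> in the shadow of \<open>S2\<close>; reversing the
  word, stripping a column leaves those with \<open>S2\<close> in the shadow of \<open>S1\<close>.  The former have
  \<open>c d1 v < b d2 u\<close>, the latter \<open>b d2 u < c d1 v\<close>, so at least one of the two numbers is zero.
\<close>

lemma greedy_coeff_eq_card_pairs:
  assumes "b > 0" and "c > 0" and "d1 > 0" and "d2 > 0"
  shows "greedy_coeff b c (d1, d2) u v = int (card (pairs b c d1 d2 u v))"
proof (rule greedy_coeff_unique[symmetric])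
  show "int (card (pairs b c d1 d2 0 0)) = 1"
    using assms by (simp add: pairs_origin)
next
  fix u v :: nat
  assume uv: "(u, v) \<noteq> (0, 0)"
  have "\<not> (shadowed_pairs c b d2 d1 v u \<noteq> {} \<and> shadowed_pairs b c d1 d2 u v \<noteq> {})"
    using shadowed_pairs_below_diagonal[OF assms, of _ _ u v]
      shadowed_pairs_below_diagonal[OF assms(2,1,4,3), of _ _ v u] uv by fastforce
  moreover have "strip (nat (d2 - c * int v)) (\<lambda>u. int (card (pairs b c d1 d2 u v))) u =
      int (card (shadowed_pairs c b d2 d1 v u))"
    using strip_card_pairs[of c d2 d1 v b u] assms by (simp add: card_pairs_flip[of d1 d2 b])
  moreover have "strip (nat (d1 - b * int u)) (\<lambda>v. int (card (pairs b c d1 d2 u v))) v =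
      int (card (shadowed_pairs b c d1 d2 u v))"
    using assms by (rule_tac strip_card_pairs)
  ultimately show "min (strip (nat (snd (d1, d2) - c * int v))
        (\<lambda>u. int (card (pairs b c d1 d2 u v))) u)
      (strip (nat (fst (d1, d2) - b * int u)) (\<lambda>v. int (card (pairs b c d1 d2 u v))) v) = 0"
    by auto
qed

lemma greedy_coeff_row_bound:
  assumes "b > 0" and "c > 0" and "greedy_coeff b c d u v \<noteq> 0"
  shows "v \<le> nat (fst d)"
proof (cases "fst d \<le> 0")
  case True
  then show ?thesis
    using greedy_coeff_nonpos_width[of b d v c u] assms by force
next
  case False
  obtain d1 d2 where d: "d = (d1, d2)" by (cases d)
  show ?thesis
  proof (cases "d2 \<le> 0")
    case True
    have "u = 0"
      using greedy_coeff_nonpos_width[of c "(d2, d1)" u b v] True assms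
      by (force simp: d greedy_coeff_swap[of b c])
    then show ?thesis
      using assms(3) by (simp add: greedy_coeff_first_row)
  next
    case False
    then have "pairs b c d1 d2 u v \<noteq> {}"
      using assms \<open>\<not> fst d \<le> 0\<close> by (auto simp: d greedy_coeff_eq_card_pairs)
    then obtain S1 where "S1 \<subseteq> h_edges d1 d2" "card S1 = v"
      by (auto simp: pairs_def)
    then have "v \<le> card (h_edges d1 d2)"
      using card_mono[of "h_edges d1 d2" S1] by simp
    then show ?thesis
      using card_h_edges[of d1 d2] False \<open>\<not> fst d \<le> 0\<close> by (simp add: d)
  qed
qed

text \<open>
  For the comparison with \<open>\<rho>\<^sub>h\<close> finiteness is not enough: the lattice points of the polytope
  have nonnegative first coordinate and therefore see only the coefficients with
  \<open>v \<le> [d\<^sub>1]\<^sub>+\<close>.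
\<close>

lemma greedy_coeff_bound:
  assumes "b > 0" and "c > 0" and "greedy_coeff b c d u v \<noteq> 0"
  shows "u \<le> nat (snd d)" and "v \<le> nat (fst d)"
  using greedy_coeff_row_bound[OF assms] greedy_coeff_row_bound[of c b "(snd d, fst d)" v u]
    greedy_coeff_swap[of b c "fst d" "snd d" u v] assms
  by simp_all

section \<open>The weights of the polytope\<close>

abbreviation "width h \<equiv> nat (- fst h)"
abbreviation "depth c h \<equiv> nat (- snd h + c * int (width h))"

lemma mem_axis_parallel_segment:
  fixes x1 x2 y u v :: real
  assumes "x1 \<le> x2"
  shows "(u, v) \<in> closed_segment (x1, y) (x2, y) \<longleftrightarrow> v = y \<and> x1 \<le> u \<and> u \<le> x2"
    and "(v, u) \<in> closed_segment (y, x1) (y, x2) \<longleftrightarrow> v = y \<and> x1 \<le> u \<and> u \<le> x2"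
proof -
  have "(1 - t) * y + t * y = y" for t
    by (simp add: algebra_simps)
  then have "(u, v) \<in> closed_segment (x1, y) (x2, y) \<longleftrightarrow> v = y \<and> u \<in> closed_segment x1 x2"
    and "(v, u) \<in> closed_segment (y, x1) (y, x2) \<longleftrightarrow> v = y \<and> u \<in> closed_segment x1 x2"
    by (auto simp: in_segment)
  then show "(u, v) \<in> closed_segment (x1, y) (x2, y) \<longleftrightarrow> v = y \<and> x1 \<le> u \<and> u \<le> x2"
    and "(v, u) \<in> closed_segment (y, x1) (y, x2) \<longleftrightarrow> v = y \<and> x1 \<le> u \<and> u \<le> x2"
    using assms by (auto simp: closed_segment_eq_real_ivl1)
qed

lemma on_segment_12:
  "on_segment (u, v) vert1 (vert2 h) \<longleftrightarrow> v = 0 \<and> 0 \<le> u \<and> u \<le> int (width h)"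
  by (auto simp: vert1_def vert2_def on_segment_def emb_def
      mem_axis_parallel_segment pos_part_eq_nat simp del: int_nat_eq)

lemma on_segment_23:
  "on_segment (u, v) (vert2 h) (vert3 c h) \<longleftrightarrow>
    u = int (width h) \<and> 0 \<le> v \<and> v \<le> int (depth c h)"
  by (auto simp: vert2_def vert3_def on_segment_def emb_def
      mem_axis_parallel_segment pos_part_eq_nat simp del: int_nat_eq)

lemma on_boundary_iff:
  "on_boundary c h (u, v) \<longleftrightarrow> v = 0 \<and> 0 \<le> u \<and> u \<le> int (width h) \<or>
    u = int (width h) \<and> 0 \<le> v \<and> v \<le> int (depth c h)"
  by (simp add: on_boundary_def on_segment_12 on_segment_23)

lemma seg_length_horizontal: "seg_length (x1, y) (x2, y) = nat \<bar>x1 - x2\<bar>"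
proof -
  have "dist (emb (x1, y)) (emb (x2, y)) = real_of_int \<bar>x1 - x2\<bar>"
    by (simp add: emb_def dist_Pair_Pair dist_real_def)
  then show ?thesis unfolding seg_length_def by (simp only: floor_of_int)
qed

lemma seg_length_vertical: "seg_length (x, y1) (x, y2) = nat \<bar>y1 - y2\<bar>"
proof -
  have "dist (emb (x, y1)) (emb (x, y2)) = real_of_int \<bar>y1 - y2\<bar>"
    by (simp add: emb_def dist_Pair_Pair dist_real_def)
  then show ?thesis unfolding seg_length_def by (simp only: floor_of_int)
qed

lemma boundary_co_bottom:
  assumes "p \<le> width h"
  shows "boundary_co c h (int (width h) - int p, 0) = int (width h choose p)"
proof -
  have "on_segment (int (width h) - int p, 0) vert1 (vert2 h)"
    using assms by (simp add: on_segment_12 del: int_nat_eq)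
  moreover have "seg_length vert1 (vert2 h) = width h"
    by (simp add: vert1_def vert2_def seg_length_horizontal pos_part_eq_nat del: int_nat_eq)
  moreover have "seg_length (int (width h) - int p, 0) (vert2 h) = p"
    by (simp add: vert2_def seg_length_horizontal pos_part_eq_nat del: int_nat_eq)
  ultimately show ?thesis by (simp add: boundary_co_def)
qed

lemma boundary_co_right:
  assumes "v \<le> depth c h"
  shows "boundary_co c h (int (width h), int v) = int (depth c h choose v)"
proof (cases "v = 0")
  case True
  then show ?thesis using boundary_co_bottom[of 0 h c] by simp
next
  case False
  then have "\<not> on_segment (int (width h), int v) vert1 (vert2 h)"
    by (simp add: on_segment_12)
  moreover have "seg_length (vert2 h) (vert3 c h) = depth c h"
    by (simp add: vert2_def vert3_def seg_length_vertical pos_part_eq_nat del: int_nat_eq)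
  moreover have "seg_length (int (width h), int v) (vert3 c h) = depth c h - v"
  proof -
    have vert3: "vert3 c h = (int (width h), int (depth c h))"
      by (simp add: vert3_def pos_part_eq_nat del: int_nat_eq)
    have "\<bar>int v - int (depth c h)\<bar> = int (depth c h - v)"
      using assms by (simp add: of_nat_diff del: int_nat_eq)
    then show ?thesis unfolding vert3 seg_length_vertical by (simp only: nat_int)
  qed
  ultimately show ?thesis
    using binomial_symmetric[OF assms] by (simp add: boundary_co_def del: int_nat_eq)
qed

lemma Ctilde_eq:
  assumes "k > 0"
  shows "Ctilde x k = int (nat x choose k)"
  using assms int_binom_of_nat[of "nat x" k] by (auto simp: Ctilde_def)

text \<open>
  The sums in the recursion for \<open>co\<close>, which run over stripped values, equal the sums in the
  greedy recursion, which run over the values themselves.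
\<close>

lemma unstrip_diff:
  "(\<Sum>k = 1..n. strip M a (n - k) * int (M choose k)) = a n - strip M a n"
proof -
  have "a n = (\<Sum>k = 0..n. strip M a (n - k) * int (M choose k))"
    using unstrip[of a n M] by (simp add: atLeast0AtMost)
  also have "\<dots> = strip M a n + (\<Sum>k = 1..n. strip M a (n - k) * int (M choose k))"
    by (subst sum.atLeast_Suc_atMost) auto
  finally show ?thesis by simp
qed

lemma weights_on_boundary:
  assumes "on_boundary c h (u, v)"
  shows "co b c h u v = boundary_co c h (u, v)"
    and "m1 b c h u v = (if u = - fst h then co b c h u v else 0)"
    and "m2 b c h u v = (if v = 0 then co b c h u v else 0)"
  by (subst co.simps m1.simps m2.simps, simp only: assms if_True)+

lemma weights_off_boundary:
  fixes b c u v :: int and h :: "int \<times> int"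
  assumes "\<not> on_boundary c h (u, v)" and "u \<le> int (width h)" and "0 \<le> v"
  defines "s1 \<equiv> \<Sum>i = 1..nat (int (width h) - u).
      m1 b c h (u + int i) v * Ctilde (- fst h - b * v) i"
    and "s2 \<equiv> \<Sum>i = 1..nat v. m2 b c h u (v - int i) * Ctilde (- snd h + c * u) i"
  shows "co b c h u v = max s1 s2"
    and "m1 b c h u v = co b c h u v - s1"
    and "m2 b c h u v = co b c h u v - s2"
proof -
  have *: "\<not> (u > pos_part (- fst h) \<or> v < 0)"
    unfolding pos_part_eq_nat using assms(2,3) by linarith
  show "co b c h u v = max s1 s2" and "m1 b c h u v = co b c h u v - s1"
    and "m2 b c h u v = co b c h u v - s2"
    unfolding s1_def s2_def pos_part_eq_nat[symmetric]
    by (subst co.simps m1.simps m2.simps, simp only: assms(1) * if_False)+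
qed

text \<open>
  The substitution is \<open>u = [-h\<^sub>1]\<^sub>+ - p\<close>: walking from the right edge of the polytope to the
  left increases the second index of the greedy coefficient.  The weight \<open>m1\<close> vanishes
  on the boundary for \<open>h\<^sub>1 > 0\<close>, while the stripped row does not; but then the polytope is a
  segment with \<open>p = 0\<close>, and no \<open>m1\<close> enters the weights on it.
\<close>

lemma weights_eq_greedy_coeff:
  fixes b c :: int and h :: "int \<times> int"
  defines "d \<equiv> (- fst h, - snd h + c * int (width h))"
  defines "g \<equiv> greedy_coeff b c d"
  assumes "p \<le> width h"
  shows "co b c h (int (width h) - int p) (int v) = g v p \<and>
    m2 b c h (int (width h) - int p) (int v) =
      strip (nat (snd d - c * int p)) (\<lambda>v. g v p) v \<and>
    (fst h \<le> 0 \<longrightarrow> m1 b c h (int (width h) - int p) (int v) =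
      strip (nat (fst d - b * int v)) (g v) p)"
  using assms(3)
proof (induction "p + v" arbitrary: p v rule: less_induct)
  case less
  define A where "A = width h"
  define D where "D = depth c h"
  define u where "u = int A - int p"
  define M1 where "M1 = strip (nat (fst d - b * int v)) (g v)"
  define M2 where "M2 = strip (nat (snd d - c * int p)) (\<lambda>v. g v p)"
  have fst_d: "nat (fst d) = A" and snd_d: "nat (snd d) = D"
    by (simp_all add: d_def A_def D_def)
  have p: "p \<le> A" using less.prems by (simp add: A_def)
  have u: "u \<le> int (width h)" "nat (int (width h) - u) = p"
    by (simp_all add: u_def A_def)
  have g_bottom: "g 0 q = int (A choose q)" for q
    using greedy_coeff_first_row[of b c d q] by (simp add: g_def fst_d)
  have g_right: "g w 0 = int (D choose w)" for w
    using greedy_coeff_first_column[of b c d w] by (simp add: g_def snd_d)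
  have boundary: "on_boundary c h (u, int v) \<longleftrightarrow> v = 0 \<or> p = 0 \<and> v \<le> D"
    unfolding on_boundary_iff u_def A_def D_def using less.prems
    by (auto simp del: int_nat_eq)
  have sum1: "(\<Sum>i = 1..nat (int (width h) - u).
      m1 b c h (u + int i) (int v) * Ctilde (- fst h - b * int v) i) = g v p - M1 p"
  proof -
    have "m1 b c h (u + int i) (int v) * Ctilde (- fst h - b * int v) i =
        M1 (p - i) * int (nat (fst d - b * int v) choose i)" if i: "i \<in> {1..p}" for i
    proof -
      have eq: "u + int i = int (width h) - int (p - i)"
        using i by (simp only: u_def A_def of_nat_diff atLeastAtMost_iff)
      have "0 < A" using i p by simp
      then have "fst h \<le> 0" by (simp add: A_def)
      have "p - i + v < p + v" "p - i \<le> width h"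
        using i less.prems by auto
      then have "m1 b c h (u + int i) (int v) = M1 (p - i)"
        unfolding eq M1_def using less.hyps[of "p - i" v] \<open>fst h \<le> 0\<close> by blast
      moreover have "Ctilde (- fst h - b * int v) i = int (nat (fst d - b * int v) choose i)"
        using i by (simp add: Ctilde_eq d_def)
      ultimately show ?thesis by (simp only:)
    qed
    then show ?thesis
      unfolding u(2) M1_def
      unfolding unstrip_diff[where a = "g v" and n = p, symmetric]
      by (intro sum.cong refl)
  qed
  have sum2: "(\<Sum>i = 1..nat (int v). m2 b c h u (int v - int i) * Ctilde (- snd h + c * u) i) =
      g v p - M2 v"
  proof -
    have "m2 b c h u (int v - int i) * Ctilde (- snd h + c * u) i =
        M2 (v - i) * int (nat (snd d - c * int p) choose i)" if i: "i \<in> {1..v}" for i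
    proof -
      have eq: "int v - int i = int (v - i)"
        using i by (simp only: of_nat_diff atLeastAtMost_iff)
      have "p + (v - i) < p + v"
        using i by auto
      then have "m2 b c h u (int v - int i) = M2 (v - i)"
        unfolding eq M2_def u_def A_def using less.hyps[of p "v - i"] less.prems by blast
      moreover have "- snd h + c * u = snd d - c * int p"
        by (simp add: d_def u_def A_def algebra_simps)
      ultimately show ?thesis
        using i by (simp add: Ctilde_eq)
    qed
    then show ?thesis
      unfolding nat_int M2_def
      unfolding unstrip_diff[where a = "\<lambda>v. g v p" and n = v, symmetric]
      by (intro sum.cong refl)
  qed
  have co: "co b c h u (int v) = g v p"
  proof (cases "on_boundary c h (u, int v)")
    case True
    then consider "v = 0" | "p = 0" "v \<le> D"
      unfolding boundary by blast
    then show ?thesis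
    proof cases
      case 1
      then show ?thesis
        using boundary_co_bottom[OF less.prems, where c = c] weights_on_boundary(1)[OF True]
        by (simp add: g_bottom u_def A_def del: int_nat_eq)
    next
      case 2
      then show ?thesis
        using boundary_co_right[where v = v and c = c and h = h] weights_on_boundary(1)[OF True]
        by (simp add: g_right u_def A_def D_def del: int_nat_eq)
    qed
  next
    case False
    have "(v, p) \<noteq> (0, 0)"
      using False by (auto simp: boundary)
    then have "g v p = max (g v p - M2 v) (g v p - M1 p)"
      unfolding g_def M1_def M2_def by (rule greedy_coeff_max)
    then show ?thesis
      using weights_off_boundary(1)[OF False u(1), where b = b] by (simp only: sum1 sum2 of_nat_0_le_iff max.commute)
  qed
  moreover have "m2 b c h u (int v) = M2 v"
  proof (cases "on_boundary c h (u, int v)")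
    case True
    then consider "v = 0" | "p = 0" "v > 0"
      unfolding boundary by blast
    then show ?thesis
    proof cases
      case 1
      then show ?thesis using weights_on_boundary(3)[OF True, where b = b] co by (simp add: M2_def)
    next
      case 2
      then have "M2 v = 0" by (simp add: M2_def snd_d g_right strip_binomial)
      then show ?thesis using weights_on_boundary(3)[OF True, where b = b] 2 by simp
    qed
  next
    case False
    then show ?thesis
      using weights_off_boundary(3)[OF False u(1), where b = b] by (simp only: sum2 co of_nat_0_le_iff)
  qed
  moreover have "m1 b c h u (int v) = M1 p" if "fst h \<le> 0"
  proof (cases "on_boundary c h (u, int v)")
    case True
    have "int A = - fst h" using that by (simp add: A_def)
    consider "p = 0" | "p > 0" "v = 0"
      using True unfolding boundary by blast
    then show ?thesis
    proof cases
      case 1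
      then show ?thesis
        using weights_on_boundary(2)[OF True, where b = b] co \<open>int A = - fst h\<close>
        by (simp add: M1_def u_def)
    next
      case 2
      then have "M1 p = 0" by (simp add: M1_def fst_d g_bottom[abs_def] strip_binomial)
      then show ?thesis
        using weights_on_boundary(2)[OF True, where b = b] 2 \<open>int A = - fst h\<close> by (simp add: u_def)
    qed
  next
    case False
    then show ?thesis
      using weights_off_boundary(2)[OF False u(1), where b = b] by (simp only: sum1 co of_nat_0_le_iff)
  qed
  ultimately show ?case
    unfolding u_def A_def M1_def M2_def by blast
qed

lemma co_eq_greedy_coeff:
  assumes "0 \<le> u" and "u \<le> int (width h)" and "0 \<le> v"
  shows "co b c h u v = greedy_coeff b c (- fst h, - snd h + c * int (width h))
    (nat v) (nat (int (width h) - u))"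
proof -
  have "nat (int (width h) - u) \<le> width h"
    using assms by linarith
  moreover have "u = int (width h) - int (nat (int (width h) - u))" "v = int (nat v)"
    using assms by (simp_all del: int_nat_eq add: nat_0_le)
  ultimately show ?thesis
    using weights_eq_greedy_coeff[of "nat (int (width h) - u)" h b c "nat v"] by metis
qed

text \<open>
  The bound on \<open>v\<close> is the bound on the support of the greedy coefficients.
\<close>

lemma co_support:
  assumes "b > 0" and "c > 0" and "0 \<le> u" and "0 \<le> v" and "co b c h u v \<noteq> 0"
  shows "u \<le> int (width h)" and "v \<le> int (depth c h)"
proof -
  show u: "u \<le> int (width h)"
  proof (rule ccontr)
    assume "\<not> ?thesis"
    then have "\<not> on_boundary c h (u, v)" "u > pos_part (- fst h) \<or> v < 0"
      unfolding on_boundary_iff pos_part_eq_nat by linarith+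
    then have "co b c h u v = 0"
      by (subst co.simps) (simp only: if_True if_False)
    with assms(5) show False by contradiction
  qed
  have "greedy_coeff b c (- fst h, - snd h + c * int (width h)) (nat v) (nat (int (width h) - u)) \<noteq> 0"
    using co_eq_greedy_coeff[OF assms(3) u assms(4)] assms(5) by metis
  then show "v \<le> int (depth c h)"
    using greedy_coeff_bound(1)[OF assms(1,2)] assms(4) by fastforce
qed

lemma N_lattice_points_subset:
  assumes "b > 0" and "c > 0"
  shows "N_lattice_points b c h \<subseteq> {0..int (width h)} \<times> {0..int (depth c h)}"
proof -
  let ?box = "{0..real (width h)} \<times> {0..real (depth c h)}"
  have "{emb (u, v) |u v. u \<ge> 0 \<and> v \<ge> 0 \<and> co b c h u v \<noteq> 0} \<subseteq> ?box"
  proof (rule subsetI)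
    fix p assume "p \<in> {emb (u, v) |u v. u \<ge> 0 \<and> v \<ge> 0 \<and> co b c h u v \<noteq> 0}"
    then obtain u v where p: "p = emb (u, v)" and "u \<ge> 0" "v \<ge> 0" "co b c h u v \<noteq> 0"
      by blast
    then have "u \<le> int (width h)" "v \<le> int (depth c h)"
      using co_support[OF assms] by blast+
    then have "real_of_int u \<le> real (width h)" "real_of_int v \<le> real (depth c h)"
      by linarith+
    then show "p \<in> ?box"
      using \<open>u \<ge> 0\<close> \<open>v \<ge> 0\<close> by (simp add: p emb_def)
  qed
  then have "N_polytope b c h \<subseteq> ?box"
    unfolding N_polytope_def by (rule hull_minimal) (simp add: convex_Times)
  then have "emb p \<in> ?box" if "p \<in> N_lattice_points b c h" for p
    using that by (auto simp: N_lattice_points_def)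
  then show ?thesis
    by (fastforce simp: emb_def simp del: int_nat_eq of_nat_nat)
qed

lemma co_eq_0_outside_N:
  assumes "0 \<le> u" and "0 \<le> v" and "(u, v) \<notin> N_lattice_points b c h"
  shows "co b c h u v = 0"
proof (rule ccontr)
  assume "co b c h u v \<noteq> 0"
  then have "emb (u, v) \<in> N_polytope b c h"
    unfolding N_polytope_def using assms by (intro hull_inc) blast
  then show False using assms(3) by (simp add: N_lattice_points_def)
qed

lemma greedy_support_subset:
  assumes "b > 0" and "c > 0"
  shows "greedy_support b c d \<subseteq> {..nat (snd d)} \<times> {..nat (fst d)}"
  using greedy_coeff_bound[OF assms, of d] by (auto simp: greedy_support_def)

section \<open>Comparing the two elements\<close>

lemma of_int_mult_monomial:
  fixes a :: "'e::monoid_add"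
  shows "of_int k * monomial a = Poly_Mapping.single a k"
  unfolding monomial_def single_of_int[symmetric] mult_single by simp

lemma y_to_1_single: "y_to_1 (Poly_Mapping.single (\<alpha>, \<beta>) k) = Poly_Mapping.single \<alpha> k"
proof -
  have *: "Poly_Mapping.single (\<alpha>, \<beta>) k = frag_cmul k (frag_of (\<alpha>, \<beta>))"
    by (rule poly_mapping_eqI) (simp add: lookup_single when_def)
  show ?thesis
    unfolding y_to_1_def * frag_extend_cmul frag_extend_of
    by (rule poly_mapping_eqI) (simp add: monomial_def lookup_single when_def)
qed

lemma yhat_power:
  "yhat1 c ^ m = monomial ((0, - c * int m), (int m, 0))"
  "yhat2 b ^ n = monomial ((b * int n, 0), (0, int n))"
proof -
  have zero: "((0, 0), (0, 0)) = (0 :: (int \<times> int) \<times> (int \<times> int))"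
    by (simp add: zero_prod_def)
  show "yhat1 c ^ m = monomial ((0, - c * int m), (int m, 0))"
    by (induction m)
      (simp_all add: zero yhat1_def monomial_def mult_single algebra_simps)
  show "yhat2 b ^ n = monomial ((b * int n, 0), (0, int n))"
    by (induction n)
      (simp_all add: zero yhat2_def monomial_def mult_single algebra_simps)
qed

lemma y_to_1_rho_term:
  assumes "0 \<le> u" and "0 \<le> v"
  shows "y_to_1 (of_int k * (yhat1 c ^ nat u * yhat2 b ^ nat v) * monomial (h, 0)) =
    Poly_Mapping.single (fst h + b * v, snd h - c * u) k"
proof -
  have "of_int k * (yhat1 c ^ nat u * yhat2 b ^ nat v) * monomial (h, 0) =
      of_int k * monomial ((0, - c * u) + (b * v, 0) + h, (u, 0) + (0, v) + 0)"
    using assms by (simp add: yhat_power monomial_def mult_single mult.assoc)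
  also have "\<dots> = Poly_Mapping.single ((0, - c * u) + (b * v, 0) + h, (u, 0) + (0, v) + 0) k"
    by (rule of_int_mult_monomial)
  finally show ?thesis
    by (simp add: y_to_1_single) (cases h, simp add: algebra_simps)
qed

text \<open>
  Both sides are sums over the box spanned by the vertices; the terms outside the polytope,
  respectively outside the greedy support, are zero.
\<close>

lemma y_to_1_rho:
  assumes "b > 0" and "c > 0"
  shows "y_to_1 (rho b c h) = greedy_element b c (- fst h, - snd h + c * int (width h))"
proof -
  define d where "d = (- fst h, - snd h + c * int (width h))"
  define A where "A = width h"
  define D where "D = depth c h"
  let ?g = "greedy_coeff b c d"
  have N: "N_lattice_points b c h \<subseteq> {0..int A} \<times> {0..int D}"
    unfolding A_def D_def by (rule N_lattice_points_subset[OF assms])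
  have "y_to_1 (rho b c h) =
      (\<Sum>(u, v)\<in>N_lattice_points b c h.
        Poly_Mapping.single (fst h + b * v, snd h - c * u) (co b c h u v))"
    unfolding rho_def y_to_1_def
    using finite_subset[OF N] N
    by (subst frag_extend_sum)
      (auto intro!: sum.cong simp: y_to_1_rho_term[unfolded y_to_1_def])
  also have "\<dots> = (\<Sum>(u, v)\<in>{0..int A} \<times> {0..int D}.
      Poly_Mapping.single (fst h + b * v, snd h - c * u) (co b c h u v))"
    by (rule sum.mono_neutral_left) (use N co_eq_0_outside_N[of _ _ b c h] in auto)
  also have "\<dots> = (\<Sum>(v, p)\<in>{..D} \<times> {..A}.
      Poly_Mapping.single (- d + (b * int v, c * int p)) (?g v p))"
  proof (rule sum.reindex_bij_witness[of _ "\<lambda>(v, p). (int A - int p, int v)"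
        "\<lambda>(u, v). (nat v, nat (int A - u))"], goal_cases)
    case (5 x)
    then obtain u v where x: "x = (u, v)" "0 \<le> u" "u \<le> int A" "0 \<le> v"
      by auto
    have "co b c h u v = ?g (nat v) (nat (int A - u))"
      using x unfolding A_def d_def by (intro co_eq_greedy_coeff)
    moreover have "- d + (b * v, c * (int A - u)) = (fst h + b * v, snd h - c * u)"
      by (simp add: d_def A_def algebra_simps)
    ultimately show ?case
      using x by simp
  qed auto
  also have "\<dots> = (\<Sum>(v, p)\<in>greedy_support b c d.
      Poly_Mapping.single (- d + (b * int v, c * int p)) (?g v p))"
  proof (rule sum.mono_neutral_right)
    show "greedy_support b c d \<subseteq> {..D} \<times> {..A}"
      using greedy_support_subset[OF assms, of d] by (simp add: d_def A_def D_def)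
  qed (auto simp: greedy_support_def)
  also have "\<dots> = greedy_element b c d"
    unfolding greedy_element_def sum_distrib_left
    by (rule sum.cong[OF refl])
      (simp only: case_prod_beta of_int_mult_monomial, simp add: monomial_def mult_single)
  finally show ?thesis by (simp only: d_def)
qed

theorem proposition3p1:
  fixes b c :: int
  assumes "b > 0" and "c > 0"
  shows "(\<forall>h. finite (N_lattice_points b c h)) \<and>
    (\<forall>d. finite (greedy_support b c d)) \<and>
    {y_to_1 (rho b c h) |h. True} = {greedy_element b c d |d. True} \<and>
    (\<forall>h\<^sub>1 h\<^sub>2. y_to_1 (rho b c (h\<^sub>1, h\<^sub>2)) =
       greedy_element b c (- h\<^sub>1, - h\<^sub>2 + c * pos_part (- h\<^sub>1)))"
proof (intro conjI)
  show "\<forall>h. finite (N_lattice_points b c h)"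
    using finite_subset[OF N_lattice_points_subset[OF assms]] by simp
  show "\<forall>d. finite (greedy_support b c d)"
    using finite_subset[OF greedy_support_subset[OF assms]] by simp
  have rho: "y_to_1 (rho b c (h1, h2)) = greedy_element b c (- h1, - h2 + c * pos_part (- h1))"
    for h1 h2
    using y_to_1_rho[OF assms, of "(h1, h2)"] by (simp only: pos_part_eq_nat fst_conv snd_conv)
  then show "\<forall>h1 h2. y_to_1 (rho b c (h1, h2)) =
      greedy_element b c (- h1, - h2 + c * pos_part (- h1))"
    by blast
  have greedy: "greedy_element b c d =
      y_to_1 (rho b c (- fst d, c * pos_part (fst d) - snd d))" for d
    by (simp add: rho)
  show "{y_to_1 (rho b c h) |h. True} = {greedy_element b c d |d. True}"
  proof (intro equalityI subsetI)
    fix x assume "x \<in> {y_to_1 (rho b c h) |h. True}"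
    then obtain h1 h2 where "x = y_to_1 (rho b c (h1, h2))" by auto
    then show "x \<in> {greedy_element b c d |d. True}" unfolding rho by blast
  next
    fix x assume "x \<in> {greedy_element b c d |d. True}"
    then obtain d where "x = greedy_element b c d" by blast
    then show "x \<in> {y_to_1 (rho b c h) |h. True}" unfolding greedy by blast
  qed
qed

end
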